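(* Let $\rho_1$ and $\rho_2$ be positive real numbers such that either (i) $\rho_1\le1$ and $\rho_2<1$, or (ii) $\rho_1<1$, $\rho_2\ge1$ and $\rho_1\rho_2<1$. Then for every $x>0$, $$\phi(-\rho_1\rho_2,0;-x)=\int_0^\infty\phi(\rho_1,0;-s)\,\phi(\rho_2,0;-xs^{\rho_2})\,\frac{ds}{s}.$$
   Context: For real $\rho\in(-1,0)\cup(0,\infty)$ and real $z$, the reduced Wright function is $\phi(\rho,0;z)=\sum_{n=1}^\infty \frac{z^n}{n!\,\Gamma(\rho n)}$, where $1/\Gamma$ is the entire reciprocal gamma function (equal to $0$ at $0,-1,-2,\ldots$). *)

theory Defs
  imports "HOL-Analysis.Analysis"
begin

text \<open>
  The series is indexed from 1. It converges for all real \<open>z\<close> when \<open>\<rho> > -1\<close>; the definition is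
  only meaningful there.
\<close>

definition reduced_wright :: "real \<Rightarrow> real \<Rightarrow> real" where
  "reduced_wright \<rho> z =
     (\<Sum>n. z ^ Suc n / fact (Suc n) * rGamma (\<rho> * real (Suc n)))"

end

theory Submission
  imports Defs "HOL-Complex_Analysis.Complex_Analysis" "HOL-Real_Asymp.Real_Asymp"
begin

text \<open>
  Fix \<open>\<theta> \<in> (\<pi>/2, \<pi>)\<close> with \<open>\<rho> \<theta> \<le> \<pi>/2\<close>. Inserting Hankel's formula for \<open>1/\<Gamma>\<close> into the series and
  shrinking the contour to the two rays \<open>arg \<zeta> = \<plusminus> \<theta>\<close> gives
  \<open>\<pi> \<phi>(\<rho>, 0; -s) = Im \<integral> exp (\<zeta> - s \<zeta>\<^sup>-\<^sup>\<rho>) d\<zeta>\<close>, where the integral is over the upper ray, for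
  \<open>0 < \<rho> < 1\<close> and \<open>s > 0\<close>.

  If \<open>\<rho>1 < 1\<close>, this yields the Mellin transform \<open>\<Gamma>(z) / \<Gamma>(- \<rho>1 z)\<close> of \<open>\<phi>(\<rho>1, 0; -s)\<close> and a bound on
  its absolute moments, which for \<open>\<rho>1 \<rho>2 < 1\<close> is strong enough to integrate the series of
  \<open>\<phi>(\<rho>2, 0; -x s\<^sup>\<rho>\<^sup>2)\<close> termwise.

  If \<open>\<rho>1 = 1\<close>, then \<open>\<phi>(1, 0; -s)\<close> is a Bessel function of linear growth with Laplace transform
  \<open>- p\<^sup>-\<^sup>2 exp (-1/p)\<close>. Writing \<open>\<phi>(\<rho>2, 0; -x s\<^sup>\<rho>\<^sup>2)\<close> as a ray integral with \<open>\<bar>\<zeta>\<bar> = s/v\<close> and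
  exchanging the integrals leaves \<open>Im \<integral> exp (\<zeta> - x \<zeta>\<^sup>\<rho>\<^sup>2) d\<zeta>\<close>, whose expansion in powers of \<open>x\<close> is
  the series of \<open>\<phi>(-\<rho>2, 0; -x)\<close>.
\<close>

subsection \<open>Gamma integrals on the half line\<close>


text \<open>Restricting the measure instead of carrying indicators gives direct access to Fubini on
  the product with itself, and \<open>AE_I2\<close> then supplies positivity of the
  variable.\<close>

definition pos_lborel :: "real measure" where
  "pos_lborel = restrict_space lborel {0<..}"

lemma space_pos_lborel [simp]: "space pos_lborel = {0<..}"
  by (simp add: pos_lborel_def space_restrict_space)

lemma measurable_ident_pos_lborel [measurable]: "(\<lambda>x. x) \<in> pos_lborel \<rightarrow>\<^sub>M borel"
  unfolding pos_lborel_def by (rule measurable_restrict_space1) simp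

interpretation pos_lborel: sigma_finite_measure pos_lborel
  unfolding pos_lborel_def
  by (rule sigma_finite_measure_restrict_space) (auto intro: lborel.sigma_finite_measure_axioms)

interpretation pos_lborel: pair_sigma_finite pos_lborel pos_lborel ..

lemma integrable_pos_lborel_iff:
  fixes f :: "real \<Rightarrow> 'a::{banach,second_countable_topology}"
  shows "integrable pos_lborel f \<longleftrightarrow> set_integrable lborel {0<..} f"
  unfolding pos_lborel_def set_integrable_def by (subst integrable_restrict_space) auto

lemma integral_pos_lborel:
  fixes f :: "real \<Rightarrow> 'a::{banach,second_countable_topology}"
  shows "integral\<^sup>L pos_lborel f = (LBINT x:{0<..}. f x)"
  unfolding pos_lborel_def set_lebesgue_integral_def by (subst integral_restrict_space) auto

text \<open>Integrability is a hypothesis, so the formula serves complex integrands along rays;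
  limits of \<open>F\<close> at both ends stand in for boundary values.\<close>

lemma pos_lborel_FTC:
  fixes f F :: "real \<Rightarrow> 'a::euclidean_space"
  assumes "\<And>x. x > 0 \<Longrightarrow> (F has_vector_derivative f x) (at x)"
    and "\<And>x. x > 0 \<Longrightarrow> isCont f x"
    and "integrable pos_lborel f"
    and "(F \<longlongrightarrow> A) (at_right 0)" and "(F \<longlongrightarrow> B) at_top"
  shows "integral\<^sup>L pos_lborel f = B - A"
proof -
  have e: "einterval 0 \<infinity> = {0<..}"
    by (auto simp: einterval_def zero_ereal_def)
  have "(LBINT x=0..\<infinity>. f x) = B - A"
    using assms by (intro interval_integral_FTC_integrable)
      (auto simp: integrable_pos_lborel_iff e zero_ereal_def einterval_eq ereal_tendsto_simps)
  then show ?thesis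
    by (simp add: interval_lebesgue_integral_def integral_pos_lborel e)
qed

lemma gamma_integral_pos:
  fixes a c :: real
  assumes "a > 0" "c > 0"
  shows "integrable pos_lborel (\<lambda>r. r powr (a - 1) * exp (- c * r))"
    and "(\<integral>r. r powr (a - 1) * exp (- c * r) \<partial>pos_lborel) = Gamma a * c powr (- a)"
proof -
  have 1: "has_bochner_integral lborel (\<lambda>t. indicator {0..} t * t powr (a - 1) / exp t) (Gamma a)"
    using assms by (intro has_bochner_integral_nn_integral)
      (auto simp: Gamma_conv_nn_integral_real[symmetric] Gamma_real_pos less_imp_le)
  have "has_bochner_integral lborel (\<lambda>t. indicator {0..} (0 + c * t) * (0 + c * t) powr (a - 1) / exp (0 + c * t)) (Gamma a /\<^sub>R \<bar>c\<bar>)"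
    using lborel_has_bochner_integral_real_affine_iff[OF less_imp_neq[OF assms(2), symmetric], THEN iffD1, OF 1, of 0] .
  \<comment> \<open>The half lines with and without 0 agree pointwise here, because
    \<open>0 powr (a - 1)\<close> is 0.\<close>
  moreover have "indicator {0..} (0 + c * t) * (0 + c * t) powr (a - 1) / exp (0 + c * t)
       = c powr (a - 1) * (indicator {0<..} t *\<^sub>R (t powr (a - 1) * exp (- c * t)))" for t
    using assms by (auto simp: indicator_def powr_mult exp_minus field_simps zero_le_mult_iff)
  ultimately have "has_bochner_integral lborel
     (\<lambda>t. c powr (a - 1) * (indicator {0<..} t *\<^sub>R (t powr (a - 1) * exp (- c * t)))) (Gamma a /\<^sub>R c)"
    using assms by simp
  from has_bochner_integral_mult_right[OF this, of "inverse (c powr (a - 1))"]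
  have "has_bochner_integral lborel
     (\<lambda>t. (indicator {0<..} t *\<^sub>R (t powr (a - 1) * exp (- c * t)))) (inverse (c powr (a - 1)) * (Gamma a /\<^sub>R c))"
    using assms by (simp add: mult.assoc[symmetric])
  moreover have "inverse (c powr (a - 1)) * (Gamma a /\<^sub>R c) = Gamma a * c powr (- a)"
    using assms by (simp add: powr_diff powr_minus divide_inverse mult_ac)
  ultimately have *: "has_bochner_integral lborel
     (\<lambda>t. (indicator {0<..} t *\<^sub>R (t powr (a - 1) * exp (- c * t)))) (Gamma a * c powr (- a))" by (simp only:)
  show "integrable pos_lborel (\<lambda>r. r powr (a - 1) * exp (- c * r))"
    using * by (simp add: integrable_pos_lborel_iff set_integrable_def has_bochner_integral_iff)
  show "(\<integral>r. r powr (a - 1) * exp (- c * r) \<partial>pos_lborel) = Gamma a * c powr (- a)"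
    using * by (simp add: integral_pos_lborel set_lebesgue_integral_def has_bochner_integral_iff)
qed

text \<open>
  \<open>exp (- p r)\<close> is expanded about a real rate \<open>c\<close> so large that \<open>\<bar>c - p\<bar> < c\<close>; integrating termwise
  gives the binomial series of \<open>p powr - a\<close>.
\<close>

lemma gamma_integral_complex_rate:
  fixes a :: real and p :: complex
  assumes a: "a > 0" and p: "Re p > 0"
  shows "integrable pos_lborel (\<lambda>r. of_real (r powr (a - 1)) * exp (- p * of_real r))"
    and "(\<integral>r. of_real (r powr (a - 1)) * exp (- p * of_real r) \<partial>pos_lborel)
           = of_real (Gamma a) * p powr (- of_real a)"
proof -
  \<comment> \<open>This choice turns |c - p|^2 = c^2 - 2 c Re p + |p|^2 into c^2 - |p|^2.\<close>
  define c where "c = (cmod p)\<^sup>2 / Re p"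
  have p0: "p \<noteq> 0" using p by auto
  have c0: "c > 0" using p p0 by (simp add: c_def)
  define q where "q = of_real c - p"
  have cq: "cmod q < c"
  proof -
    have "(cmod q)\<^sup>2 = (c - Re p)\<^sup>2 + (Im p)\<^sup>2" by (simp add: q_def cmod_power2)
    also have "\<dots> = c\<^sup>2 - 2 * c * Re p + (cmod p)\<^sup>2" unfolding cmod_power2 by (simp add: power2_eq_square algebra_simps)
    also have "\<dots> = c\<^sup>2 - (cmod p)\<^sup>2" using p by (simp add: c_def)
    also have "\<dots> < c\<^sup>2" using p0 by simp
    finally show ?thesis using c0 by (simp add: power_less_imp_less_base)
  qed
  define f where "f k r = of_real (r powr (a + real k - 1) * exp (- c * r)) * (q ^ k / fact k)" for k r
  have trm: "f k r = of_real (r powr (a - 1) * exp (- c * r)) * ((q * of_real r) ^ k / fact k)" if "r > 0" for k r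
  proof -
    have "r powr (a + real k - 1) = r powr (a - 1) * r ^ k"
      using that by (simp add: powr_realpow[symmetric] powr_add[symmetric] algebra_simps)
    then show ?thesis by (simp add: f_def power_mult_distrib)
  qed
  have sumf: "(\<lambda>k. f k r) sums (of_real (r powr (a - 1)) * exp (- p * of_real r))" if "r > 0" for r
  proof -
    have "(\<lambda>k. (q * of_real r) ^ k / fact k) sums exp (q * of_real r)"
      using exp_converges[of "q * of_real r"] by (simp add: scaleR_conv_of_real divide_inverse mult_ac)
    from sums_mult[OF this, of "of_real (r powr (a - 1) * exp (- c * r))"]
    have "(\<lambda>k. f k r) sums (of_real (r powr (a - 1) * exp (- c * r)) * exp (q * of_real r))"
      using trm[OF that] by simp
    also have "of_real (r powr (a - 1) * exp (- c * r)) * exp (q * of_real r) = of_real (r powr (a - 1)) * exp (- p * of_real r)"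
      by (simp add: exp_of_real[symmetric] exp_add[symmetric] q_def algebra_simps)
    finally show ?thesis .
  qed
  have int: "integrable pos_lborel (f k)" for k
    unfolding f_def using gamma_integral_pos(1)[of "a + real k" c] a c0
    by (intro integrable_mult_left integrable_of_real) auto
  have intv: "(\<integral>r. f k r \<partial>pos_lborel) = of_real (Gamma (a + real k) * c powr (- (a + real k))) * (q ^ k / fact k)" for k
    unfolding f_def using gamma_integral_pos[of "a + real k" c] a c0
    by (subst integral_mult_left_zero, subst integral_complex_of_real) simp
  have intn: "(\<integral>r. norm (f k r) \<partial>pos_lborel) = (Gamma (a + real k) * c powr (- (a + real k))) * (cmod q ^ k / fact k)" for k
  proof -
    have "(\<integral>r. norm (f k r) \<partial>pos_lborel) = (\<integral>r. r powr (a + real k - 1) * exp (- c * r) * (cmod q ^ k / fact k) \<partial>pos_lborel)"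
      unfolding f_def by (simp add: norm_mult norm_divide norm_power)
    also have "\<dots> = (Gamma (a + real k) * c powr (- (a + real k))) * (cmod q ^ k / fact k)"
      using gamma_integral_pos[of "a + real k" c] a c0
      by (subst integral_mult_left_zero) simp
    finally show ?thesis .
  qed
  \<comment> \<open>Stated for general \<open>z\<close> because it serves twice: at
    \<open>cmod q\<close> for summability of the integrated norms, at \<open>q\<close> for the
    value.\<close>
  have binom: "(\<lambda>k. of_real (Gamma (a + real k) * c powr (- (a + real k))) * (z ^ k / fact k)) sums
       (of_real (Gamma a * c powr - a) * (1 - z / of_real c) powr (- of_real a))" if "cmod z < c" for z
  proof -
    have "cmod (- z / of_real c) < 1" using that c0 by (simp add: norm_divide)
    from gen_binomial_complex[OF this, of "- of_real a"]
    have "(\<lambda>n. (- of_real a gchoose n) * (- z / of_real c) ^ n) sums (1 + - z / of_real c) powr - of_real a" .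
    from sums_mult[OF this, of "of_real (Gamma a * c powr - a)"]
    have "(\<lambda>n. of_real (Gamma a * c powr - a) * ((- of_real a gchoose n) * (- z / of_real c) ^ n)) sums
       (of_real (Gamma a * c powr - a) * (1 - z / of_real c) powr (- of_real a))" by simp
    moreover have "of_real (Gamma a * c powr - a) * ((- of_real a gchoose n) * (- z / of_real c) ^ n)
       = of_real (Gamma (a + real n) * c powr (- (a + real n))) * (z ^ n / fact n)" for n
    proof -
      have *: "Gamma (a + real n) = Gamma a * pochhammer a n"
        using a by (subst pochhammer_Gamma) (auto simp: Gamma_eq_zero_iff elim!: nonpos_Ints_cases)
      have "c powr (- (a + real n)) = c powr - a / c ^ n"
        using c0 powr_diff[of c "- a" "real n"] by (simp add: powr_realpow)
      moreover have "(-1) ^ n * (- z / of_real c) ^ n = z ^ n / of_real c ^ n"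
        by (simp flip: power_mult_distrib power_divide)
      moreover have "of_real (Gamma a * c powr - a) * ((- of_real a gchoose n) * (- z / of_real c) ^ n)
          = of_real (Gamma a * c powr - a * pochhammer a n / fact n) * ((-1) ^ n * (- z / of_real c) ^ n)"
        by (simp add: gbinomial_pochhammer pochhammer_of_real del: power_minus_mult)
      ultimately show ?thesis unfolding * by (simp add: mult_ac)
    qed
    ultimately show ?thesis by simp
  qed
  have "(\<lambda>k. of_real (Gamma (a + real k) * c powr (- (a + real k))) * (of_real (cmod q) ^ k / fact k) :: complex) sums
       (of_real (Gamma a * c powr - a) * (1 - of_real (cmod q) / of_real c) powr (- of_real a))"
    using cq by (intro binom) auto
  then have "summable (\<lambda>k. complex_of_real (Gamma (a + real k) * c powr (- (a + real k)) * (cmod q ^ k / fact k)))"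
    by (simp add: sums_iff)
  then have summ: "summable (\<lambda>k. \<integral>r. norm (f k r) \<partial>pos_lborel)"
    unfolding intn summable_of_real_iff .
  have ae: "AE r in pos_lborel. summable (\<lambda>k. norm (f k r))"
  proof (rule AE_I2)
    fix r assume "r \<in> space pos_lborel"
    then have r: "r > 0" by simp
    have "summable (\<lambda>k. \<bar>r powr (a - 1) * exp (- c * r)\<bar> * ((cmod q * r) ^ k / fact k))"
      using summable_exp[of "cmod q * r"] by (intro summable_mult) (simp add: divide_inverse mult_ac)
    then show "summable (\<lambda>k. norm (f k r))"
      using r by (simp add: trm norm_mult norm_divide norm_power power_mult_distrib)
  qed
  have eq: "(\<Sum>k. f k r) = of_real (r powr (a - 1)) * exp (- p * of_real r)" if "r \<in> space pos_lborel" for r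
    using sumf[of r] that by (simp add: sums_iff)
  show "integrable pos_lborel (\<lambda>r. of_real (r powr (a - 1)) * exp (- p * of_real r))"
    using integrable_suminf[OF int ae summ] by (subst Bochner_Integration.integrable_cong[OF refl eq[symmetric]]) auto
  have "(\<integral>r. of_real (r powr (a - 1)) * exp (- p * of_real r) \<partial>pos_lborel) = (\<integral>r. (\<Sum>k. f k r) \<partial>pos_lborel)"
    by (intro Bochner_Integration.integral_cong refl eq[symmetric])
  also have "\<dots> = (\<Sum>k. \<integral>r. f k r \<partial>pos_lborel)"
    by (rule integral_suminf[OF int ae summ])
  also have "\<dots> = of_real (Gamma a * c powr - a) * (1 - q / of_real c) powr (- of_real a)"
    unfolding intv using binom[OF cq] by (simp add: sums_iff)
  also have "1 - q / of_real c = p / of_real c" using c0 by (simp add: q_def field_simps)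
  \<comment> \<open>A positive real factor does not change the argument, so \<open>c\<close> may be
    moved into the complex power.\<close>
  also have "of_real (Gamma a * c powr - a) * (p / of_real c) powr (- of_real a)
      = of_real (Gamma a) * (of_real c * (p / of_real c)) powr (- of_real a)"
    using c0 by (subst powr_times_real_left) (auto simp: powr_of_real[symmetric])
  also have "of_real c * (p / of_real c) = p" using c0 by simp
  finally show "(\<integral>r. of_real (r powr (a - 1)) * exp (- p * of_real r) \<partial>pos_lborel)
           = of_real (Gamma a) * p powr (- of_real a)" .
qed


subsection \<open>Integrals along rays\<close>

text \<open>Otherwise the simplifier pulls the factor \<open>cis \<theta>\<close> out of every ray integral.\<close>

declare integral_mult_left_zero [simp del] integral_mult_right_zero [simp del]

lemma continuous_on_measurable_pos_lborel:
  fixes f :: "real \<Rightarrow> 'a::topological_space"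
  assumes "continuous_on {0<..} f"
  shows "f \<in> borel_measurable pos_lborel"
proof -
  have "f \<in> borel_measurable (restrict_space borel {0<..})"
    by (rule borel_measurable_continuous_on_restrict) fact
  also have "borel_measurable (restrict_space borel {0<..}) = (borel_measurable pos_lborel :: (real \<Rightarrow> 'a) set)"
    by (rule measurable_cong_sets) (auto simp: pos_lborel_def sets_restrict_space)
  finally show ?thesis .
qed

lemma integrable_pos_lborel_bound:
  fixes f :: "real \<Rightarrow> 'a::{banach,second_countable_topology}"
  assumes "f \<in> borel_measurable pos_lborel" "a > 0" "c > 0"
    and "\<And>r. r > 0 \<Longrightarrow> norm (f r) \<le> C * (r powr (a - 1) * exp (- c * r))"
  shows "integrable pos_lborel f"
proof (rule Bochner_Integration.integrable_bound[OF _ assms(1)])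
  show "integrable pos_lborel (\<lambda>r. C * (r powr (a - 1) * exp (- c * r)))"
    using gamma_integral_pos(1)[OF assms(2,3)] by simp
  show "AE r in pos_lborel. norm (f r) \<le> norm (C * (r powr (a - 1) * exp (- c * r)))"
    by (rule AE_I2) (use assms(4) in \<open>force intro: order_trans\<close>)
qed

lemma cos_obtuse_neg: "pi / 2 < \<theta> \<Longrightarrow> \<theta> < pi \<Longrightarrow> cos \<theta> < 0"
  using cos_gt_zero_pi[of "pi - \<theta>"] by simp

lemma cmod_powr_of_real: "z \<noteq> 0 \<Longrightarrow> cmod (z powr of_real y) = cmod z powr y"
  by (simp add: powr_def)

lemma rcis_powr:
  assumes "r > 0" "t \<in> {-pi<..pi}"
  shows "(of_real r * cis t) powr of_real y = of_real (r powr y) * cis (y * t)"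
proof -
  have "Ln (of_real r * cis t) = of_real (ln r) + of_real t * \<i>"
    using assms by (subst Ln_times_of_real) (auto simp: Ln_cis Ln_of_real)
  then show ?thesis using assms
    by (simp add: powr_def cis_conv_exp exp_add[symmetric] exp_of_real[symmetric] algebra_simps)
qed

text \<open>Euler's reflection formula at -y; for y > -1 the value \<open>Gamma (1 + y)\<close> is
  positive and cancels \<open>rGamma (1 + y)\<close>.\<close>

lemma rGamma_reflection_real: "rGamma (- y) = - sin (pi * y) / pi * Gamma (1 + y)" if "y > -1" for y :: real
proof -
  have "sin (of_real pi * of_real y :: complex) = of_real (sin (pi * y))"
    by (metis of_real_mult sin_of_real)
  then have "of_real (rGamma (- y) * rGamma (1 + y)) = (of_real (- sin (pi * y) / pi) :: complex)"
    using rGamma_reflection_complex[of "of_real (- y)"]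
    by (simp add: rGamma_complex_of_real[symmetric])
  then have "rGamma (- y) * rGamma (1 + y) = - sin (pi * y) / pi"
    by (simp only: of_real_eq_iff)
  moreover have "rGamma (1 + y) * Gamma (1 + y) = 1"
    using that Gamma_real_pos[of "1 + y"] by (simp add: rGamma_inverse_Gamma less_imp_neq[symmetric] del: Gamma_eq_zero_iff)
  ultimately show ?thesis
    by (metis mult.assoc mult.right_neutral)
qed

text \<open>Hankel's formula on the contour collapsed to the origin, possible because r^y is
  integrable at 0. The gamma integral with rate \<open>- cis \<theta>\<close> gives
  \<open>Gamma (1 + y)\<close> times \<open>cis (pi * y + pi)\<close>, whose imaginary part the
  reflection formula identifies.\<close>

lemma ray_rGamma:
  fixes y \<theta> :: real
  assumes y: "y > -1" and \<theta>: "pi / 2 < \<theta>" "\<theta> < pi"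
  shows "integrable pos_lborel (\<lambda>r. exp (of_real r * cis \<theta>) * (of_real (r powr y) * cis (y * \<theta>)) * cis \<theta>)"
    and "Im (\<integral>r. exp (of_real r * cis \<theta>) * (of_real (r powr y) * cis (y * \<theta>)) * cis \<theta> \<partial>pos_lborel) = pi * rGamma (- y)"
proof -
  have c: "cos \<theta> < 0" using \<theta> by (rule cos_obtuse_neg)
  note g = gamma_integral_complex_rate[of "1 + y" "- cis \<theta>"]
  have i: "integrable pos_lborel (\<lambda>r. of_real (r powr y) * exp (of_real r * cis \<theta>))"
    using g(1) y c by (simp add: mult_ac)
  have e: "exp (of_real r * cis \<theta>) * (of_real (r powr y) * cis (y * \<theta>)) * cis \<theta> =
      (of_real (r powr y) * exp (of_real r * cis \<theta>)) * (cis (y * \<theta>) * cis \<theta>)" for r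
    by (simp add: mult_ac)
  show "integrable pos_lborel (\<lambda>r. exp (of_real r * cis \<theta>) * (of_real (r powr y) * cis (y * \<theta>)) * cis \<theta>)"
    unfolding e using i by (rule integrable_mult_left)
  \<comment> \<open>In this form the angle \<theta> - pi is the principal argument, as
    \<open>rcis_powr\<close> requires.\<close>
  have m: "- cis \<theta> = of_real 1 * cis (\<theta> - pi)" by (simp add: complex_eq_iff)
  have "(\<integral>r. of_real (r powr y) * exp (of_real r * cis \<theta>) \<partial>pos_lborel) = of_real (Gamma (1 + y)) * (- cis \<theta>) powr (of_real (- (1 + y)))"
    using g(2) y c by (simp add: mult_ac)
  also have "(- cis \<theta>) powr (of_real (- (1 + y))) = cis (- (1 + y) * (\<theta> - pi))"
    unfolding m using \<theta> by (subst rcis_powr) auto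
  finally have v: "(\<integral>r. exp (of_real r * cis \<theta>) * (of_real (r powr y) * cis (y * \<theta>)) * cis \<theta> \<partial>pos_lborel)
      = of_real (Gamma (1 + y)) * (cis (- (1 + y) * (\<theta> - pi)) * cis (y * \<theta>) * cis \<theta>)"
    unfolding e by (subst integral_mult_left_zero) (simp add: mult_ac)
  have "cis (- (1 + y) * (\<theta> - pi)) * cis (y * \<theta>) * cis \<theta> = cis (pi * y + pi)"
    by (simp add: cis_mult algebra_simps)
  then show "Im (\<integral>r. exp (of_real r * cis \<theta>) * (of_real (r powr y) * cis (y * \<theta>)) * cis \<theta> \<partial>pos_lborel) = pi * rGamma (- y)"
    unfolding v using rGamma_reflection_real[OF y] by (simp add: sin_add)
qed

lemma ray_notin_nonpos_Reals:
  assumes "0 < \<theta>" "\<theta> < pi" "d \<ge> 0" "r \<ge> 0" "d > 0 \<or> r > 0"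
  shows "of_real d + of_real r * cis \<theta> \<notin> \<real>\<^sub>\<le>\<^sub>0"
  using assms sin_gt_zero[of \<theta>] by (auto simp: complex_nonpos_Reals_iff)

lemma slit_plane_eq: "- (complex_of_real ` {..0}) = - \<real>\<^sub>\<le>\<^sub>0"
  by (auto simp: nonpos_Reals_def elim!: Reals_cases)

text \<open>
  A primitive \<open>H\<close> of \<open>f\<close> on the slit plane has constant imaginary part on the positive reals, so
  moving the vertex of the ray along the reals does not change the imaginary part of the integral.
\<close>

lemma ray_shift:
  fixes f :: "complex \<Rightarrow> complex" and \<theta> a C :: real
  assumes \<theta>: "pi / 2 < \<theta>" "\<theta> < pi" and a: "a < 1"
    and hol: "f holomorphic_on - \<real>\<^sub>\<le>\<^sub>0"
    and real: "\<And>x. x > 0 \<Longrightarrow> Im (f (of_real x)) = 0"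
    and bd: "\<And>d r. 0 < d \<Longrightarrow> d \<le> 1 \<Longrightarrow> r > 0 \<Longrightarrow>
               cmod (f (of_real d + of_real r * cis \<theta>)) \<le> C * (r powr (- a) * exp (cos \<theta> * r))"
  shows "Im (\<integral>r. f (1 + of_real r * cis \<theta>) * cis \<theta> \<partial>pos_lborel) = Im (\<integral>r. f (of_real r * cis \<theta>) * cis \<theta> \<partial>pos_lborel)"
proof -
  have c: "cos \<theta> < 0" using \<theta> by (rule cos_obtuse_neg)
  have \<theta>0: "0 < \<theta>" using \<theta> pi_gt_zero by linarith
  note notin = ray_notin_nonpos_Reals[OF \<theta>0 \<theta>(2)]
  have contf: "continuous_on (- \<real>\<^sub>\<le>\<^sub>0) f" using hol by (rule holomorphic_on_imp_continuous_on)
  have contr: "isCont (\<lambda>r. f (of_real d + of_real r * cis \<theta>) * cis \<theta>) r" if "d \<ge> 0" "r > 0" for d r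
  proof -
    have "isCont f (of_real d + of_real r * cis \<theta>)"
      using contf notin[of d r] that by (auto simp: continuous_on_eq_continuous_at open_Compl)
    moreover have "isCont (\<lambda>r. of_real d + of_real r * cis \<theta>) r" by (intro continuous_intros)
    ultimately have "isCont (\<lambda>r. f (of_real d + of_real r * cis \<theta>)) r"
      by (rule isCont_o2[rotated])
    then show ?thesis by (intro continuous_intros)
  qed
  have meas: "(\<lambda>r. f (of_real d + of_real r * cis \<theta>) * cis \<theta>) \<in> borel_measurable pos_lborel" if "d \<ge> 0" for d
    using contr[OF that]
    by (intro continuous_on_measurable_pos_lborel) (auto simp: continuous_on_eq_continuous_at)
  have bd': "cmod (f (of_real d + of_real r * cis \<theta>) * cis \<theta>) \<le> C * (r powr (1 - a - 1) * exp (- (- cos \<theta>) * r))"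
    if "0 < d" "d \<le> 1" "r > 0" for d r
    using bd[OF that] by (simp add: norm_mult)
  have int: "integrable pos_lborel (\<lambda>r. f (of_real d + of_real r * cis \<theta>) * cis \<theta>)" if "0 < d" "d \<le> 1" for d
    using meas[of d] bd' a c that by (intro integrable_pos_lborel_bound[where a = "1 - a" and c = "- cos \<theta>"]) auto
  obtain H where H: "\<And>x. x \<in> - \<real>\<^sub>\<le>\<^sub>0 \<Longrightarrow> (H has_field_derivative f x) (at x)"
    using holomorphic_starlike_primitive[of "- \<real>\<^sub>\<le>\<^sub>0" f "{}"] contf hol starlike_slotted_complex_plane_left[of 0]
    unfolding slit_plane_eq by (auto simp: holomorphic_on_imp_differentiable_at open_Compl)
  have ImH: "Im (H (of_real d)) = Im (H 1)" if "d > 0" for d :: real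
  proof -
    have "((\<lambda>x. Im (H (of_real x))) has_field_derivative 0) (at x within {0<..})" if "x > 0" for x :: real
    proof -
      have "((\<lambda>x. H (of_real x)) has_vector_derivative f (of_real x)) (at x within {0<..})"
        using that by (intro has_vector_derivative_real_field H)
          (auto simp: complex_nonpos_Reals_iff intro: has_field_derivative_at_within)
      from bounded_linear.has_vector_derivative[OF bounded_linear_Im this]
      show ?thesis using real[OF that] by (simp add: has_real_derivative_iff_has_vector_derivative)
    qed
    then obtain k where "\<forall>x\<in>{0<..}. Im (H (of_real x)) = k"
      using has_field_derivative_zero_constant[of "{0<..}" "\<lambda>x. Im (H (of_real x))"] by auto
    then show ?thesis using that by (metis greaterThan_iff of_real_1 zero_less_one)
  qed
  \<comment> \<open>The origin lies on the slit, where \<open>H\<close> gives no information. So the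
    vertex 1 is first compared with vertices d > 0, and d tends to 0 afterwards.\<close>
  have key: "Im (\<integral>r. f (of_real d + of_real r * cis \<theta>) * cis \<theta> \<partial>pos_lborel) = Im (\<integral>r. f (1 + of_real r * cis \<theta>) * cis \<theta> \<partial>pos_lborel)"
    if d: "0 < d" "d \<le> 1" for d
  proof -
    \<comment> \<open>The difference of the primitive along two parallel rays. It tends to 0 at
      infinity, since a segment of length 1 - d joins the two points and \<open>bd\<close> bounds
      \<open>f\<close> on it; at r = 0 it is H 1 - H d, a real number by \<open>ImH\<close>.\<close>
    define G where "G r = H (1 + of_real r * cis \<theta>) - H (of_real d + of_real r * cis \<theta>)" for r
    have der: "((\<lambda>r. H (of_real b + of_real r * cis \<theta>)) has_vector_derivative f (of_real b + of_real r * cis \<theta>) * cis \<theta>) (at r)"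
      if "b > 0" "r \<ge> 0" for b r
    proof -
      have "((\<lambda>r. of_real b + of_real r * cis \<theta>) has_vector_derivative cis \<theta>) (at r)"
        by (auto intro!: derivative_eq_intros simp: has_vector_derivative_def scaleR_conv_of_real)
      from field_vector_diff_chain_at[OF this H] notin[of b r] that show ?thesis
        by (simp add: o_def mult.commute)
    qed
    have "(\<integral>r. f (of_real 1 + of_real r * cis \<theta>) * cis \<theta> - f (of_real d + of_real r * cis \<theta>) * cis \<theta> \<partial>pos_lborel) = 0 - (H 1 - H (of_real d))"
    proof (rule pos_lborel_FTC[where F = G])
      show "(G has_vector_derivative f (of_real 1 + of_real x * cis \<theta>) * cis \<theta> - f (of_real d + of_real x * cis \<theta>) * cis \<theta>) (at x)" if "x > 0" for x
        unfolding G_def using der[of 1 x] der[of d x] d that by (intro derivative_intros) auto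
      show "isCont (\<lambda>x. f (of_real 1 + of_real x * cis \<theta>) * cis \<theta> - f (of_real d + of_real x * cis \<theta>) * cis \<theta>) x" if "x > 0" for x
        using contr[of 1 x] contr[of d x] that d by (intro continuous_diff) auto
      show "integrable pos_lborel (\<lambda>x. f (of_real 1 + of_real x * cis \<theta>) * cis \<theta> - f (of_real d + of_real x * cis \<theta>) * cis \<theta>)"
        using int[of 1] int[of d] d by (intro Bochner_Integration.integrable_diff) auto
      have "isCont G 0"
        unfolding G_def using der[of 1 0] der[of d 0] d
        by (intro continuous_diff) (auto dest: has_vector_derivative_continuous)
      then have "(G \<longlongrightarrow> G 0) (at_right 0)"
        by (simp add: isCont_def filterlim_at_split)
      then show "(G \<longlongrightarrow> H 1 - H (of_real d)) (at_right 0)"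
        by (simp add: G_def)
      have le: "cmod (G r) \<le> C * (r powr (- a) * exp (cos \<theta> * r)) * cmod (1 - of_real d)" if r: "r > 0" for r
      proof -
        define w where "w = of_real r * cis \<theta>"
        have seg: "\<exists>t. d \<le> t \<and> t \<le> 1 \<and> z = of_real t + w" if "z \<in> closed_segment (of_real d + w) (1 + w)" for z
        proof -
          from that obtain u where u: "0 \<le> u" "u \<le> 1" "z = (1 - u) *\<^sub>R (of_real d + w) + u *\<^sub>R (1 + w)"
            by (auto simp: closed_segment_def)
          have "d * (1 - u) \<le> 1 * (1 - u)" using u d by (intro mult_right_mono) auto
          moreover have "u * d \<le> u" using u d by (simp add: mult_left_le)
          moreover have "z = of_real ((1 - u) * d + u) + w"
            by (simp add: u(3) scaleR_conv_of_real algebra_simps)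
          moreover have "d \<le> (1 - u) * d + u" "(1 - u) * d + u \<le> 1"
            using calculation(1,2) by (auto simp: algebra_simps)
          ultimately show ?thesis by blast
        qed
        have "cmod (H (1 + w) - H (of_real d + w)) \<le> C * (r powr (- a) * exp (cos \<theta> * r)) * cmod ((1 + w) - (of_real d + w))"
        proof (rule field_differentiable_bound[of "closed_segment (of_real d + w) (1 + w)"])
          fix z assume "z \<in> closed_segment (of_real d + w) (1 + w)"
          from seg[OF this] obtain t where t: "d \<le> t" "t \<le> 1" and z: "z = of_real t + of_real r * cis \<theta>"
            unfolding w_def by blast
          show "(H has_field_derivative f z) (at z within closed_segment (of_real d + w) (1 + w))"
            unfolding z using notin[of t r] t(1) d r by (intro has_field_derivative_at_within[OF H]) simp
          show "cmod (f z) \<le> C * (r powr (- a) * exp (cos \<theta> * r))"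
            unfolding z using bd[of t r] t d r by simp
        qed auto
        then show ?thesis by (simp add: G_def w_def)
      qed
      have "((\<lambda>r. r powr (- a) * exp (cos \<theta> * r)) \<longlongrightarrow> 0) at_top"
        using c by real_asymp
      then have "((\<lambda>r. C * (r powr (- a) * exp (cos \<theta> * r)) * cmod (1 - of_real d)) \<longlongrightarrow> 0) at_top"
        by (intro tendsto_mult_left_zero tendsto_mult_right_zero)
      then show "(G \<longlongrightarrow> 0) at_top"
        by (rule Lim_null_comparison[rotated])
          (use le in \<open>auto intro!: eventually_at_top_linorderI[of 1]\<close>)
    qed
    moreover have "(\<integral>r. f (of_real 1 + of_real r * cis \<theta>) * cis \<theta> - f (of_real d + of_real r * cis \<theta>) * cis \<theta> \<partial>pos_lborel)
      = (\<integral>r. f (of_real 1 + of_real r * cis \<theta>) * cis \<theta> \<partial>pos_lborel) - (\<integral>r. f (of_real d + of_real r * cis \<theta>) * cis \<theta> \<partial>pos_lborel)"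
      using int[of 1] int[of d] d by (intro Bochner_Integration.integral_diff) auto
    ultimately have "Im ((\<integral>r. f (1 + of_real r * cis \<theta>) * cis \<theta> \<partial>pos_lborel) - (\<integral>r. f (of_real d + of_real r * cis \<theta>) * cis \<theta> \<partial>pos_lborel)) = Im (0 - (H 1 - H (of_real d)))"
      by simp
    then show ?thesis using ImH[OF d(1)] by simp
  qed
  \<comment> \<open>The bound \<open>bd\<close> is uniform in d, and integrable at 0 since a < 1, so
    dominated convergence applies as the vertex tends to 0.\<close>
  define D where "D n = inverse (real (Suc n))" for n
  have D: "0 < D n" "D n \<le> 1" "D \<longlonglongrightarrow> 0" for n
    using LIMSEQ_inverse_real_of_nat unfolding D_def[abs_def] by (auto simp: inverse_le_1_iff)
  have lim: "(\<lambda>n. f (of_real (D n) + of_real r * cis \<theta>) * cis \<theta>) \<longlonglongrightarrow> f (of_real r * cis \<theta>) * cis \<theta>" if "r > 0" for r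
  proof -
    have "isCont f (of_real 0 + of_real r * cis \<theta>)"
      using contf notin[of 0 r] that by (auto simp: continuous_on_eq_continuous_at open_Compl)
    moreover have "(\<lambda>n. of_real (D n) + of_real r * cis \<theta>) \<longlonglongrightarrow> of_real 0 + of_real r * cis \<theta>"
      by (intro tendsto_intros D)
    ultimately have "(\<lambda>n. f (of_real (D n) + of_real r * cis \<theta>)) \<longlonglongrightarrow> f (of_real 0 + of_real r * cis \<theta>)"
      by (rule isCont_tendsto_compose)
    then show ?thesis by (auto intro!: tendsto_intros)
  qed
  have m0: "(\<lambda>r. f (of_real r * cis \<theta>) * cis \<theta>) \<in> borel_measurable pos_lborel"
    using meas[of 0] by simp
  have mD: "(\<lambda>r. f (of_real (D n) + of_real r * cis \<theta>) * cis \<theta>) \<in> borel_measurable pos_lborel" for n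
    using meas[of "D n"] D(1)[of n] by simp
  have ib: "integrable pos_lborel (\<lambda>r. C * (r powr (1 - a - 1) * exp (- (- cos \<theta>) * r)))"
    using a c by (intro integrable_mult_right gamma_integral_pos) auto
  have ael: "AE r in pos_lborel. (\<lambda>n. f (of_real (D n) + of_real r * cis \<theta>) * cis \<theta>) \<longlonglongrightarrow> f (of_real r * cis \<theta>) * cis \<theta>"
    using lim by (intro AE_I2) simp
  have aeb: "AE r in pos_lborel. norm (f (of_real (D n) + of_real r * cis \<theta>) * cis \<theta>) \<le> C * (r powr (1 - a - 1) * exp (- (- cos \<theta>) * r))" for n
    using bd'[OF D(1,2)] by (intro AE_I2) simp
  have "(\<lambda>n. \<integral>r. f (of_real (D n) + of_real r * cis \<theta>) * cis \<theta> \<partial>pos_lborel) \<longlonglongrightarrow> (\<integral>r. f (of_real r * cis \<theta>) * cis \<theta> \<partial>pos_lborel)"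
    by (rule integral_dominated_convergence[OF m0 mD ib ael aeb])
  then have "(\<lambda>n. Im (\<integral>r. f (of_real (D n) + of_real r * cis \<theta>) * cis \<theta> \<partial>pos_lborel)) \<longlonglongrightarrow> Im (\<integral>r. f (of_real r * cis \<theta>) * cis \<theta> \<partial>pos_lborel)"
    by (rule tendsto_Im)
  then show "Im (\<integral>r. f (1 + of_real r * cis \<theta>) * cis \<theta> \<partial>pos_lborel) = Im (\<integral>r. f (of_real r * cis \<theta>) * cis \<theta> \<partial>pos_lborel)"
    unfolding key[OF D(1,2)] by (simp add: LIMSEQ_const_iff)
qed


subsection \<open>Hankel's formula on a wedge\<close>

text \<open>A modulus is at least the absolute imaginary part, which is r sin \<theta> for the point
  itself and d sin \<theta> after rotation by \<open>cis (- \<theta>)\<close>.\<close>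

lemma ray_cmod_ge:
  assumes "0 < \<theta>" "\<theta> < pi" "d \<ge> 0" "r \<ge> 0"
  shows "r * sin \<theta> \<le> cmod (of_real d + of_real r * cis \<theta>)" "d * sin \<theta> \<le> cmod (of_real d + of_real r * cis \<theta>)"
proof -
  have s: "sin \<theta> > 0" using assms by (intro sin_gt_zero)
  show "r * sin \<theta> \<le> cmod (of_real d + of_real r * cis \<theta>)"
    using abs_Im_le_cmod[of "of_real d + of_real r * cis \<theta>"] by simp
  have "(of_real d + of_real r * cis \<theta>) * cis (- \<theta>) = of_real d * cis (- \<theta>) + of_real r"
    by (simp add: distrib_right mult.assoc cis_mult)
  then have "cmod (of_real d + of_real r * cis \<theta>) = cmod (of_real d * cis (- \<theta>) + of_real r)"
    by (metis mult.right_neutral norm_cis norm_mult)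
  then show "d * sin \<theta> \<le> cmod (of_real d + of_real r * cis \<theta>)"
    using abs_Im_le_cmod[of "of_real d * cis (- \<theta>) + of_real r"] s assms by simp
qed

text \<open>The ray from 1 keeps distance at least sin \<theta> from the origin, so the negative
  power stays bounded; the real part 1 + r cos \<theta> supplies the decay.\<close>

lemma hankel_integrand_bound:
  fixes \<theta> a r :: real
  assumes \<theta>: "pi / 2 < \<theta>" "\<theta> < pi" and "a \<ge> 0" "r \<ge> 0"
  defines "\<zeta> \<equiv> 1 + of_real r * cis \<theta>"
  shows "cmod (exp \<zeta> * \<zeta> powr of_real (- a)) \<le> exp 1 * sin \<theta> powr (- a) * exp (cos \<theta> * r)"
proof -
  have \<theta>0: "0 < \<theta>" using \<theta> pi_gt_zero by linarith
  have s: "sin \<theta> > 0" using \<theta>0 \<theta> by (intro sin_gt_zero)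
  have g: "sin \<theta> \<le> cmod \<zeta>"
    using ray_cmod_ge(2)[OF \<theta>0 \<theta>(2), of 1 r] assms by simp
  then have "\<zeta> \<noteq> 0" using s by auto
  then have "cmod (\<zeta> powr of_real (- a)) \<le> sin \<theta> powr (- a)"
    using g s \<open>a \<ge> 0\<close> unfolding cmod_powr_of_real[OF \<open>\<zeta> \<noteq> 0\<close>] by (intro powr_mono2') auto
  moreover have "cmod (exp \<zeta>) = exp 1 * exp (cos \<theta> * r)"
    by (simp add: \<zeta>_def exp_add[symmetric] mult_ac)
  ultimately show ?thesis by (simp add: norm_mult mult_ac)
qed

lemma powr_continuous_ray:
  assumes \<theta>: "pi / 2 < \<theta>" "\<theta> < pi" and r: "r \<ge> 0"
  shows "isCont (\<lambda>r. (1 + of_real r * cis \<theta>) powr c) r"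
proof -
  have \<theta>0: "0 < \<theta>" using \<theta> pi_gt_zero by linarith
  show ?thesis
    using ray_notin_nonpos_Reals[OF \<theta>0 \<theta>(2), of 1 r] r
    by (intro continuous_intros) (auto simp: complex_nonpos_Reals_iff)
qed

lemma hankel_continuous:
  assumes \<theta>: "pi / 2 < \<theta>" "\<theta> < pi" and r: "r \<ge> 0"
  shows "isCont (\<lambda>r. exp (1 + of_real r * cis \<theta>) * (1 + of_real r * cis \<theta>) powr c) r"
  by (rule continuous_mult[OF _ powr_continuous_ray[OF \<theta> r]]) (intro continuous_intros)

lemma hankel_integrable:
  fixes \<theta> a :: real
  assumes \<theta>: "pi / 2 < \<theta>" "\<theta> < pi" and a: "a \<ge> 0"
  shows "integrable pos_lborel (\<lambda>r. exp (1 + of_real r * cis \<theta>) * (1 + of_real r * cis \<theta>) powr of_real (- a) * cis \<theta>)"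
proof (rule integrable_pos_lborel_bound[where a = 1 and c = "- cos \<theta>" and C = "exp 1 * sin \<theta> powr (- a)"])
  show "(\<lambda>r. exp (1 + of_real r * cis \<theta>) * (1 + of_real r * cis \<theta>) powr of_real (- a) * cis \<theta>) \<in> borel_measurable pos_lborel"
    using hankel_continuous[OF \<theta>]
    by (intro continuous_on_measurable_pos_lborel continuous_at_imp_continuous_on ballI continuous_mult[OF _ continuous_const]) auto
  show "0 < - cos \<theta>" using cos_obtuse_neg[OF \<theta>] by simp
qed (use hankel_integrand_bound[OF \<theta> a] in \<open>simp_all add: norm_mult mult_ac\<close>)

text \<open>Integration by parts along the ray, the counterpart of 1/\<Gamma>(a) = a/\<Gamma>(a +
  1). The boundary term at the vertex 1 is the real number -e, which the imaginary part does not
  see.\<close>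

lemma hankel_parts:
  fixes \<theta> a :: real
  assumes \<theta>: "pi / 2 < \<theta>" "\<theta> < pi" and a: "a \<ge> 0"
  shows "Im (\<integral>r. exp (1 + of_real r * cis \<theta>) * (1 + of_real r * cis \<theta>) powr of_real (- a) * cis \<theta> \<partial>pos_lborel)
       = a * Im (\<integral>r. exp (1 + of_real r * cis \<theta>) * (1 + of_real r * cis \<theta>) powr of_real (- (a + 1)) * cis \<theta> \<partial>pos_lborel)"
proof -
  have c: "cos \<theta> < 0" using \<theta> by (rule cos_obtuse_neg)
  have \<theta>0: "0 < \<theta>" using \<theta> pi_gt_zero by linarith
  define h where "h a r = exp (1 + of_real r * cis \<theta>) * (1 + of_real r * cis \<theta>) powr of_real (- a) * cis \<theta>" for a r :: real
  define F where "F r = exp (1 + of_real r * cis \<theta>) * (1 + of_real r * cis \<theta>) powr of_real (- a)" for r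
  have ih: "integrable pos_lborel (h b)" if "b \<ge> 0" for b
    unfolding h_def by (rule hankel_integrable[OF \<theta> that])
  have "(\<integral>r. h a r - of_real a * h (a + 1) r \<partial>pos_lborel) = 0 - exp 1"
  proof (rule pos_lborel_FTC[where F = F])
    fix r :: real assume r: "r > 0"
    have ns: "1 + of_real r * cis \<theta> \<notin> \<real>\<^sub>\<le>\<^sub>0"
      using ray_notin_nonpos_Reals[OF \<theta>0 \<theta>(2), of 1 r] r by simp
    have *: "((\<lambda>z. exp z * z powr of_real (- a)) has_field_derivative
         exp z * z powr of_real (- a) - of_real a * (exp z * z powr of_real (- (a + 1)))) (at z)" if "z \<notin> \<real>\<^sub>\<le>\<^sub>0" for z :: complex
    proof -
      have e: "complex_of_real (- (a + 1)) = - of_real a - 1" by simp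
      show ?thesis unfolding e using that by (auto intro!: derivative_eq_intros simp: algebra_simps)
    qed
    have "((\<lambda>r. 1 + of_real r * cis \<theta>) has_vector_derivative cis \<theta>) (at r)"
      by (auto intro!: derivative_eq_intros simp: has_vector_derivative_def scaleR_conv_of_real)
    from field_vector_diff_chain_at[OF this *[OF ns]]
    show "(F has_vector_derivative h a r - of_real a * h (a + 1) r) (at r)"
      by (simp add: F_def[abs_def] h_def o_def algebra_simps)
    show "isCont (\<lambda>r. h a r - of_real a * h (a + 1) r) r"
      unfolding h_def using r
      by (intro continuous_diff continuous_mult[OF continuous_const] continuous_mult[OF _ continuous_const] hankel_continuous[OF \<theta>]) auto
  next
    show "integrable pos_lborel (\<lambda>r. h a r - of_real a * h (a + 1) r)"
      using ih[of a] ih[of "a + 1"] a by (intro Bochner_Integration.integrable_diff integrable_mult_right) auto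
    have "isCont F 0"
      unfolding F_def by (rule hankel_continuous[OF \<theta>]) simp
    then have "(F \<longlongrightarrow> F 0) (at_right 0)" by (simp add: isCont_def filterlim_at_split)
    then show "(F \<longlongrightarrow> exp 1) (at_right 0)" by (simp add: F_def)
    have "((\<lambda>r. exp (cos \<theta> * r)) \<longlongrightarrow> 0) at_top" using c by real_asymp
    then have "((\<lambda>r. exp 1 * sin \<theta> powr (- a) * exp (cos \<theta> * r)) \<longlongrightarrow> 0) at_top"
      by (rule tendsto_mult_right_zero)
    then show "(F \<longlongrightarrow> 0) at_top"
      by (rule Lim_null_comparison[rotated])
        (use hankel_integrand_bound[OF \<theta> a] in \<open>auto simp: F_def intro!: eventually_at_top_linorderI[of 0]\<close>)
  qed
  moreover have "(\<integral>r. h a r - of_real a * h (a + 1) r \<partial>pos_lborel) = (\<integral>r. h a r \<partial>pos_lborel) - of_real a * (\<integral>r. h (a + 1) r \<partial>pos_lborel)"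
    using ih[of a] ih[of "a + 1"] a by (subst Bochner_Integration.integral_diff) auto
  ultimately have "Im ((\<integral>r. h a r \<partial>pos_lborel) - of_real a * (\<integral>r. h (a + 1) r \<partial>pos_lborel)) = Im (- exp 1)"
    by simp
  moreover have "Im (exp 1) = 0" by (metis Im_complex_of_real exp_of_real of_real_1)
  ultimately show ?thesis
    unfolding h_def by simp
qed

text \<open>For a < 1 the singularity of z^(-a) at 0 is integrable, so \<open>ray_shift\<close>
  moves the vertex from 1 to 0, where \<open>ray_rGamma\<close> with y = -a gives the value.\<close>

lemma hankel_wedge_less_one:
  fixes \<theta> a :: real
  assumes \<theta>: "pi / 2 < \<theta>" "\<theta> < pi" and a: "a \<ge> 0" "a < 1"
  shows "Im (\<integral>r. exp (1 + of_real r * cis \<theta>) * (1 + of_real r * cis \<theta>) powr of_real (- a) * cis \<theta> \<partial>pos_lborel) = pi * rGamma a"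
proof -
  have \<theta>0: "0 < \<theta>" using \<theta> pi_gt_zero by linarith
  have s: "sin \<theta> > 0" using \<theta>0 \<theta> by (intro sin_gt_zero)
  define f :: "complex \<Rightarrow> complex" where "f z = exp z * z powr of_real (- a)" for z
  have "Im (\<integral>r. f (1 + of_real r * cis \<theta>) * cis \<theta> \<partial>pos_lborel) = Im (\<integral>r. f (of_real r * cis \<theta>) * cis \<theta> \<partial>pos_lborel)"
  proof (rule ray_shift[OF \<theta> a(2), where C = "exp 1 * sin \<theta> powr (- a)"])
    show "f holomorphic_on - \<real>\<^sub>\<le>\<^sub>0"
      unfolding f_def by (intro holomorphic_intros) auto
    show "Im (f (of_real x)) = 0" if "x > 0" for x
    proof -
      have "f (of_real x) = of_real (exp x * x powr (- a))"
        using that by (simp add: f_def powr_of_real[symmetric] exp_of_real[symmetric])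
      then show ?thesis by simp
    qed
    show "cmod (f (of_real d + of_real r * cis \<theta>)) \<le> exp 1 * sin \<theta> powr (- a) * (r powr (- a) * exp (cos \<theta> * r))"
      if "0 < d" "d \<le> 1" "r > 0" for d r
    proof -
      let ?z = "of_real d + of_real r * cis \<theta>"
      have g: "r * sin \<theta> \<le> cmod ?z" using ray_cmod_ge(1)[OF \<theta>0 \<theta>(2), of d r] that by simp
      moreover have p: "r * sin \<theta> > 0" using that s by simp
      ultimately have "?z \<noteq> 0" by (metis norm_zero not_le)
      then have "cmod (?z powr of_real (- a)) = cmod ?z powr (- a)" by (rule cmod_powr_of_real)
      also have "\<dots> \<le> (r * sin \<theta>) powr (- a)" using g p a by (intro powr_mono2') auto
      also have "\<dots> = r powr (- a) * sin \<theta> powr (- a)" using that s by (simp add: powr_mult)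
      finally have "cmod (?z powr of_real (- a)) \<le> r powr (- a) * sin \<theta> powr (- a)" .
      moreover have "cmod (exp ?z) \<le> exp 1 * exp (cos \<theta> * r)"
        using that by (simp add: exp_add[symmetric] mult_ac)
      ultimately have "cmod (exp ?z) * cmod (?z powr of_real (- a)) \<le> (exp 1 * exp (cos \<theta> * r)) * (r powr (- a) * sin \<theta> powr (- a))"
        by (intro mult_mono) auto
      then show ?thesis by (simp add: f_def norm_mult mult_ac)
    qed
  qed
  also have "(\<integral>r. f (of_real r * cis \<theta>) * cis \<theta> \<partial>pos_lborel) =
     (\<integral>r. exp (of_real r * cis \<theta>) * (of_real (r powr (- a)) * cis ((- a) * \<theta>)) * cis \<theta> \<partial>pos_lborel)"
    unfolding f_def using \<theta> by (intro Bochner_Integration.integral_cong refl) (subst rcis_powr, auto)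
  also have "Im \<dots> = pi * rGamma a"
    using ray_rGamma(2)[of "- a" \<theta>] \<theta> a by simp
  finally show ?thesis unfolding f_def .
qed

text \<open>
  The induction on \<open>a\<close> by parts cannot reach \<open>1\<close> from \<open>0\<close>, since \<open>1/\<Gamma>(0) = 0\<close>; the value at \<open>1\<close> is a limit
  from below.
\<close>

lemma hankel_wedge_one:
  fixes \<theta> :: real
  assumes \<theta>: "pi / 2 < \<theta>" "\<theta> < pi"
  shows "Im (\<integral>r. exp (1 + of_real r * cis \<theta>) * (1 + of_real r * cis \<theta>) powr of_real (- 1) * cis \<theta> \<partial>pos_lborel) = pi * rGamma 1"
proof -
  have \<theta>0: "0 < \<theta>" using \<theta> pi_gt_zero by linarith
  have s: "sin \<theta> > 0" using \<theta>0 \<theta> by (intro sin_gt_zero)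
  define h where "h a r = exp (1 + of_real r * cis \<theta>) * (1 + of_real r * cis \<theta>) powr of_real (- a) * cis \<theta>" for a r :: real
  define A where "A n = 1 - inverse (real (Suc n))" for n
  have A01: "0 \<le> A n" "A n < 1" for n by (auto simp: A_def inverse_le_1_iff)
  have A: "A \<longlonglongrightarrow> 1 - 0"
    unfolding A_def by (intro tendsto_diff tendsto_const LIMSEQ_inverse_real_of_nat)
  have "(\<lambda>n. integral\<^sup>L pos_lborel (h (A n))) \<longlonglongrightarrow> integral\<^sup>L pos_lborel (h 1)"
  proof (rule integral_dominated_convergence)
    show "h 1 \<in> borel_measurable pos_lborel" "\<And>n. h (A n) \<in> borel_measurable pos_lborel"
      using hankel_integrable[OF \<theta>] A01 by (auto simp: h_def[abs_def] intro!: borel_measurable_integrable)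
    show "integrable pos_lborel (\<lambda>r. exp 1 * sin \<theta> powr (- 1) * (r powr (1 - 1) * exp (- (- cos \<theta>) * r)))"
      using cos_obtuse_neg[OF \<theta>] by (intro integrable_mult_right gamma_integral_pos) auto
    show "AE r in pos_lborel. (\<lambda>n. h (A n) r) \<longlonglongrightarrow> h 1 r"
    proof (rule AE_I2)
      fix r assume "r \<in> space pos_lborel"
      then have "1 + of_real r * cis \<theta> \<notin> \<real>\<^sub>\<le>\<^sub>0"
        using ray_notin_nonpos_Reals[OF \<theta>0 \<theta>(2), of 1 r] by simp
      then have "1 + of_real r * cis \<theta> \<noteq> 0" by auto
      then show "(\<lambda>n. h (A n) r) \<longlonglongrightarrow> h 1 r"
        unfolding h_def powr_def using A by (auto intro!: tendsto_eq_intros)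
    qed
    show "AE r in pos_lborel. norm (h (A n) r) \<le> exp 1 * sin \<theta> powr (- 1) * (r powr (1 - 1) * exp (- (- cos \<theta>) * r))" for n
    proof (rule AE_I2)
      fix r assume "r \<in> space pos_lborel"
      then have r: "r > 0" by simp
      have "norm (h (A n) r) \<le> exp 1 * sin \<theta> powr (- A n) * exp (cos \<theta> * r)"
        using hankel_integrand_bound[OF \<theta> A01(1), of r n] r by (simp add: h_def norm_mult)
      \<comment> \<open>As sin \<theta> is at most 1, the exponent -1 gives a bound that is uniform
        in n.\<close>
      also have "\<dots> \<le> exp 1 * sin \<theta> powr (- 1) * exp (cos \<theta> * r)"
        using s A01(2)[of n] by (intro mult_right_mono mult_left_mono powr_mono') auto
      finally show "norm (h (A n) r) \<le> exp 1 * sin \<theta> powr (- 1) * (r powr (1 - 1) * exp (- (- cos \<theta>) * r))"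
        using r by simp
    qed
  qed
  then have "(\<lambda>n. Im (integral\<^sup>L pos_lborel (h (A n)))) \<longlonglongrightarrow> Im (integral\<^sup>L pos_lborel (h 1))"
    by (rule tendsto_Im)
  moreover have "Im (integral\<^sup>L pos_lborel (h (A n))) = pi * rGamma (A n)" for n
    using hankel_wedge_less_one[OF \<theta> A01] by (simp add: h_def[abs_def])
  moreover have "(\<lambda>n. pi * rGamma (A n)) \<longlonglongrightarrow> pi * rGamma 1"
    using A by (intro tendsto_mult tendsto_const isCont_tendsto_compose[where g = rGamma] continuous_intros) auto
  ultimately show ?thesis
    unfolding h_def using LIMSEQ_unique by force
qed

text \<open>Hankel's formula, with the Hankel contour replaced by the wedge \<open>1 + r cis (\<plusminus> \<theta>)\<close>.\<close>

lemma hankel_wedge: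
  fixes \<theta> a :: real
  assumes \<theta>: "pi / 2 < \<theta>" "\<theta> < pi" and a: "a \<ge> 0"
  shows "Im (\<integral>r. exp (1 + of_real r * cis \<theta>) * (1 + of_real r * cis \<theta>) powr of_real (- a) * cis \<theta> \<partial>pos_lborel) = pi * rGamma a"
proof -
  \<comment> \<open>Induction on an integer bound for a: if a > 1, integration by parts lowers a to
    a - 1 > 0, and the factor a - 1 cancels. The value a = 0 is taken from
    \<open>hankel_wedge_less_one\<close>.\<close>
  have "0 < a \<Longrightarrow> a \<le> 1 + real n \<Longrightarrow>
     Im (\<integral>r. exp (1 + of_real r * cis \<theta>) * (1 + of_real r * cis \<theta>) powr of_real (- a) * cis \<theta> \<partial>pos_lborel) = pi * rGamma a" for n
  proof (induction n arbitrary: a)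
    case 0
    then show ?case
      using hankel_wedge_less_one[OF \<theta>, of a] hankel_wedge_one[OF \<theta>] by (cases "a = 1") auto
  next
    case (Suc n)
    show ?case
    proof (cases "a \<le> 1")
      case True
      then show ?thesis
        using Suc.prems hankel_wedge_less_one[OF \<theta>, of a] hankel_wedge_one[OF \<theta>] by (cases "a = 1") auto
    next
      case False
      then have "(a - 1) * Im (\<integral>r. exp (1 + of_real r * cis \<theta>) * (1 + of_real r * cis \<theta>) powr of_real (- a) * cis \<theta> \<partial>pos_lborel)
          = pi * rGamma (a - 1)"
        using hankel_parts[OF \<theta>, of "a - 1"] Suc.IH[of "a - 1"] Suc.prems by simp
      also have "\<dots> = (a - 1) * (pi * rGamma a)"
        using rGamma_plus1[of "a - 1"] by (simp add: mult_ac)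
      finally show ?thesis using False by simp
    qed
  qed
  from this[of "nat \<lceil>a\<rceil>"] show ?thesis
    using hankel_wedge_less_one[OF \<theta>, of a] a by (cases "a = 0") (auto, linarith)
qed


subsection \<open>Ray integrals for the reduced Wright function\<close>

lemma summable_exp_of_real: "summable (\<lambda>n. K ^ n / fact n)" for K :: real
  using summable_exp[of K] by (simp add: divide_inverse mult.commute)

text \<open>Expanding exp (z \<zeta>^(-\<rho>)) and integrating termwise turns each term into
  \<open>hankel_wedge\<close> with a = \<rho> n. On the ray from 1 the power \<zeta>^(-\<rho>) is
  bounded, so the integrated norms are dominated by an exponential series.\<close>

lemma reduced_wright_sums_wedge:
  fixes \<rho> z \<theta> :: real
  assumes \<rho>: "\<rho> > 0" and \<theta>: "pi / 2 < \<theta>" "\<theta> < pi"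
  shows "(\<lambda>n. z ^ Suc n / fact (Suc n) * rGamma (\<rho> * real (Suc n))) sums
    (Im (\<integral>r. exp ((1 + of_real r * cis \<theta>) + of_real z * (1 + of_real r * cis \<theta>) powr of_real (- \<rho>)) * cis \<theta> \<partial>pos_lborel) / pi)"
proof -
  have \<theta>0: "0 < \<theta>" using \<theta> pi_gt_zero by linarith
  have c: "cos \<theta> < 0" using \<theta> by (rule cos_obtuse_neg)
  define h where "h a r = exp (1 + of_real r * cis \<theta>) * (1 + of_real r * cis \<theta>) powr of_real (- a) * cis \<theta>" for a r :: real
  define T where "T n r = of_real (z ^ n / fact n) * h (\<rho> * real n) r" for n r
  have ih: "integrable pos_lborel (h (\<rho> * real n))" for n
    unfolding h_def using \<rho> by (intro hankel_integrable[OF \<theta>]) auto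
  have int: "integrable pos_lborel (T n)" for n
    unfolding T_def using ih by (intro integrable_mult_right) auto
  have nz: "1 + of_real r * cis \<theta> \<noteq> 0" if "r > 0" for r
    using ray_notin_nonpos_Reals[OF \<theta>0 \<theta>(2), of 1 r] that by auto
  have Teq: "T n r = (of_real z * (1 + of_real r * cis \<theta>) powr of_real (- \<rho>)) ^ n / fact n * (exp (1 + of_real r * cis \<theta>) * cis \<theta>)"
    if "r > 0" for n r
    using nz[OF that] by (simp add: T_def h_def power_mult_distrib powr_power mult_ac)
  have sumT: "(\<lambda>n. T n r) sums (exp ((1 + of_real r * cis \<theta>) + of_real z * (1 + of_real r * cis \<theta>) powr of_real (- \<rho>)) * cis \<theta>)"
    if "r > 0" for r
  proof -
    have "(\<lambda>n. w ^ n / fact n) sums exp w" for w :: complex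
      using exp_converges[of w] by (simp add: scaleR_conv_of_real divide_inverse mult_ac)
    from sums_mult2[OF this[of "of_real z * (1 + of_real r * cis \<theta>) powr of_real (- \<rho>)"], of "exp (1 + of_real r * cis \<theta>) * cis \<theta>"] show ?thesis
      unfolding Teq[OF that] by (simp add: exp_add mult_ac)
  qed
  have sn: "summable (\<lambda>n. norm (T n r))" if "r > 0" for r
  proof -
    have "summable (\<lambda>n. cmod (of_real z * (1 + of_real r * cis \<theta>) powr of_real (- \<rho>)) ^ n / fact n * cmod (exp (1 + of_real r * cis \<theta>) * cis \<theta>))"
      by (intro summable_mult2 summable_exp_of_real)
    then show ?thesis unfolding Teq[OF that] by (simp add: norm_mult norm_divide norm_power)
  qed
  have bd: "norm (T n r) \<le> ((\<bar>z\<bar> * sin \<theta> powr (- \<rho>)) ^ n / fact n * exp 1) * (r powr (1 - 1) * exp (- (- cos \<theta>) * r))" if "r > 0" for n r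
  proof -
    have "sin \<theta> \<noteq> 0" using \<theta>0 \<theta> sin_gt_zero[of \<theta>] by auto
    then have "sin \<theta> powr (- (\<rho> * real n)) = (sin \<theta> powr (- \<rho>)) ^ n"
      by (simp add: powr_power mult_ac)
    moreover have "norm (h (\<rho> * real n) r) \<le> exp 1 * sin \<theta> powr (- (\<rho> * real n)) * exp (cos \<theta> * r)"
      using hankel_integrand_bound[OF \<theta>, of "\<rho> * real n" r] \<rho> that by (simp add: h_def norm_mult)
    ultimately have "norm (T n r) \<le> \<bar>z\<bar> ^ n / fact n * (exp 1 * (sin \<theta> powr (- \<rho>)) ^ n * exp (cos \<theta> * r))"
      by (auto simp: T_def norm_mult norm_divide norm_power intro!: divide_right_mono mult_left_mono)
    then show ?thesis using that by (simp add: power_mult_distrib mult_ac)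
  qed
  have sni: "summable (\<lambda>n. \<integral>r. norm (T n r) \<partial>pos_lborel)"
  proof (rule summable_comparison_test')
    note g = gamma_integral_pos[of 1 "- cos \<theta>"]
    show "summable (\<lambda>n. ((\<bar>z\<bar> * sin \<theta> powr (- \<rho>)) ^ n / fact n * exp 1) * (\<integral>r. r powr (1 - 1) * exp (- (- cos \<theta>) * r) \<partial>pos_lborel))"
      by (intro summable_mult2 summable_exp_of_real)
    show "norm (\<integral>r. norm (T n r) \<partial>pos_lborel) \<le> ((\<bar>z\<bar> * sin \<theta> powr (- \<rho>)) ^ n / fact n * exp 1) * (\<integral>r. r powr (1 - 1) * exp (- (- cos \<theta>) * r) \<partial>pos_lborel)" for n
    proof -
      have "(\<integral>r. norm (T n r) \<partial>pos_lborel) \<le> (\<integral>r. ((\<bar>z\<bar> * sin \<theta> powr (- \<rho>)) ^ n / fact n * exp 1) * (r powr (1 - 1) * exp (- (- cos \<theta>) * r)) \<partial>pos_lborel)"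
        using g c int bd by (intro integral_mono integrable_norm integrable_mult_right) auto
      then show ?thesis by (simp only: integral_mult_right_zero) simp
    qed
  qed
  have "(\<lambda>n. integral\<^sup>L pos_lborel (T n)) sums (\<integral>r. (\<Sum>n. T n r) \<partial>pos_lborel)"
    using sn by (intro sums_integral int sni) (auto intro!: AE_I2)
  also have "(\<integral>r. (\<Sum>n. T n r) \<partial>pos_lborel) =
     (\<integral>r. exp ((1 + of_real r * cis \<theta>) + of_real z * (1 + of_real r * cis \<theta>) powr of_real (- \<rho>)) * cis \<theta> \<partial>pos_lborel)"
    using sumT by (intro Bochner_Integration.integral_cong) (auto simp: sums_iff)
  finally have "(\<lambda>n. Im (integral\<^sup>L pos_lborel (T n)) / pi) sums (Im \<dots> / pi)"
    by (intro sums_divide sums_Im)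
  moreover have "Im (integral\<^sup>L pos_lborel (T n)) / pi = z ^ n / fact n * rGamma (\<rho> * real n)" for n
  proof -
    have "integral\<^sup>L pos_lborel (T n) = of_real (z ^ n / fact n) * integral\<^sup>L pos_lborel (h (\<rho> * real n))"
      unfolding T_def by (simp only: integral_mult_right_zero)
    also have "Im \<dots> = z ^ n / fact n * Im (integral\<^sup>L pos_lborel (h (\<rho> * real n)))"
      by (simp only: Im_complex_of_real Re_complex_of_real times_complex.simps mult_zero_left add_0_right)
    also have "Im (integral\<^sup>L pos_lborel (h (\<rho> * real n))) = pi * rGamma (\<rho> * real n)"
      using hankel_wedge[OF \<theta>, of "\<rho> * real n"] \<rho> by (simp add: h_def[abs_def])
    finally show ?thesis by simp
  qed
  \<comment> \<open>Dropping the term n = 0 leaves the sum unchanged, since that term contains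
    \<open>rGamma 0\<close>, which is 0.\<close>
  ultimately show ?thesis
    by (subst sums_Suc_iff) simp
qed

text \<open>A point above the real axis and to the right of the ray has argument between 0 and
  \<theta>, so the argument of its power -\<rho> lies in [-pi/2, 0].\<close>

lemma Re_powr_neg_nonneg_ray:
  fixes \<rho> \<theta> d r :: real
  assumes \<rho>: "\<rho> > 0" and \<theta>: "pi / 2 < \<theta>" "\<theta> < pi" "\<rho> * \<theta> \<le> pi / 2" and d: "d > 0" and r: "r > 0"
  shows "Re ((of_real d + of_real r * cis \<theta>) powr of_real (- \<rho>)) \<ge> 0"
proof -
  have \<theta>0: "0 < \<theta>" using \<theta> pi_gt_zero by linarith
  have s: "sin \<theta> > 0" using \<theta>0 \<theta> by (intro sin_gt_zero)
  define \<zeta> where "\<zeta> = of_real d + of_real r * cis \<theta>"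
  have "Im \<zeta> > 0" using r s by (simp add: \<zeta>_def)
  then have nz: "\<zeta> \<noteq> 0" and a0: "Arg \<zeta> \<ge> 0" by (auto simp: Arg_less_0)
  \<comment> \<open>If the argument exceeded \<theta>, rotation by \<open>cis (- \<theta>)\<close>
    would leave the point in the closed upper half plane; but its imaginary part becomes - d sin
    \<theta> < 0.\<close>
  have "Arg \<zeta> \<le> \<theta>"
  proof (rule ccontr)
    assume "\<not> Arg \<zeta> \<le> \<theta>"
    then have "sin (Arg \<zeta> - \<theta>) \<ge> 0" using Arg_le_pi[of \<zeta>] \<theta>0 by (intro sin_ge_zero) auto
    moreover have "\<zeta> * cis (- \<theta>) = of_real (cmod \<zeta>) * cis (Arg \<zeta> - \<theta>)"
      using rcis_cmod_Arg[of \<zeta>] by (simp add: rcis_def cis_mult flip: mult.assoc) (metis cis_mult mult.assoc uminus_add_conv_diff add.commute)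
    then have "Im (\<zeta> * cis (- \<theta>)) = cmod \<zeta> * sin (Arg \<zeta> - \<theta>)" by simp
    moreover have "\<zeta> * cis (- \<theta>) = of_real d * cis (- \<theta>) + of_real r"
      by (simp add: \<zeta>_def distrib_right mult.assoc cis_mult)
    then have "Im (\<zeta> * cis (- \<theta>)) = - d * sin \<theta>" by simp
    moreover have "d * sin \<theta> > 0" using d s by simp
    ultimately show False by (metis mult_nonneg_nonneg norm_ge_zero minus_mult_left neg_0_le_iff_le not_le)
  qed
  then have "\<rho> * Arg \<zeta> \<le> \<rho> * \<theta>" "\<rho> * Arg \<zeta> \<ge> 0"
    using \<rho> a0 by (auto intro: mult_left_mono)
  then have "\<rho> * Arg \<zeta> \<le> pi / 2" "\<rho> * Arg \<zeta> \<ge> - (pi / 2)"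
    using \<theta>(3) pi_gt_zero by linarith+
  then have "cos (\<rho> * Arg \<zeta>) \<ge> 0" by (intro cos_ge_zero) auto
  moreover have "Re (\<zeta> powr of_real (- \<rho>)) = exp (- \<rho> * ln (cmod \<zeta>)) * cos (\<rho> * Arg \<zeta>)"
    using nz by (simp add: powr_def Re_exp Arg_eq_Im_Ln)
  ultimately show ?thesis unfolding \<zeta>_def by simp
qed

text \<open>Although \<zeta>^(-\<rho>) is unbounded near 0, its real part is nonnegative on the
  shifted rays. Hence exp (- s \<zeta>^(-\<rho>)) has modulus at most 1, and
  \<open>ray_shift\<close> with a = 0 brings the wedge to the origin.\<close>

lemma reduced_wright_ray:
  fixes \<rho> \<theta> s :: real
  assumes \<rho>: "\<rho> > 0" and \<theta>: "pi / 2 < \<theta>" "\<theta> < pi" "\<rho> * \<theta> \<le> pi / 2" and s: "s > 0"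
  shows "Im (\<integral>r. exp (of_real r * cis \<theta> - of_real (s * r powr (- \<rho>)) * cis (- (\<rho> * \<theta>))) * cis \<theta> \<partial>pos_lborel)
       = pi * reduced_wright \<rho> (- s)"
proof -
  have \<theta>0: "0 < \<theta>" using \<theta> pi_gt_zero by linarith
  define f :: "complex \<Rightarrow> complex" where "f z = exp (z - of_real s * z powr of_real (- \<rho>))" for z
  have "Im (\<integral>r. f (1 + of_real r * cis \<theta>) * cis \<theta> \<partial>pos_lborel) = Im (\<integral>r. f (of_real r * cis \<theta>) * cis \<theta> \<partial>pos_lborel)"
  proof (rule ray_shift[OF \<theta>(1,2), where a = 0 and C = "exp 1"])
    show "f holomorphic_on - \<real>\<^sub>\<le>\<^sub>0"
      unfolding f_def by (intro holomorphic_intros) auto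
    show "Im (f (of_real x)) = 0" if "x > 0" for x
    proof -
      have "f (of_real x) = of_real (exp (x - s * x powr (- \<rho>)))"
        using that by (simp add: f_def powr_of_real[symmetric] exp_of_real[symmetric])
      then show ?thesis by simp
    qed
    show "cmod (f (of_real d + of_real r * cis \<theta>)) \<le> exp 1 * (r powr - 0 * exp (cos \<theta> * r))"
      if "0 < d" "d \<le> 1" "r > 0" for d r
    proof -
      have "s * Re ((of_real d + of_real r * cis \<theta>) powr of_real (- \<rho>)) \<ge> 0"
        using Re_powr_neg_nonneg_ray[OF \<rho> \<theta>, of d r] s that by simp
      then have "cmod (f (of_real d + of_real r * cis \<theta>)) \<le> exp (1 + cos \<theta> * r)"
        using that by (simp add: f_def mult.commute)
      then show ?thesis using that by (simp add: exp_add)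
    qed
  qed auto
  also have "(\<integral>r. f (of_real r * cis \<theta>) * cis \<theta> \<partial>pos_lborel) =
     (\<integral>r. exp (of_real r * cis \<theta> - of_real (s * r powr (- \<rho>)) * cis (- (\<rho> * \<theta>))) * cis \<theta> \<partial>pos_lborel)"
    unfolding f_def using \<theta>0 \<theta> by (intro Bochner_Integration.integral_cong refl) (subst rcis_powr, auto simp: mult_ac)
  finally show ?thesis
    using reduced_wright_sums_wedge[OF \<rho> \<theta>(1,2), of "- s"]
    by (simp add: f_def reduced_wright_def sums_iff)
qed

section \<open>Summability of K^n \<Gamma>(1 + lam n) / n! for lam < 1\<close>

text \<open>The threshold \<open>(K / c) powr (1 / (1 - lam))\<close> is where K r^lam = c r: up to
  it the power is at most its value there, beyond it the linear term is larger.\<close>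

lemma powr_le_linear:
  fixes K c lam r :: real
  assumes "K > 0" "0 < lam" "lam < 1" "c > 0" "r > 0"
  shows "K * r powr lam \<le> c * r + K * ((K / c) powr (1 / (1 - lam))) powr lam"
proof (cases "r \<le> (K / c) powr (1 / (1 - lam))")
  case True
  then have "r powr lam \<le> ((K / c) powr (1 / (1 - lam))) powr lam"
    using assms by (intro powr_mono2) auto
  then have "K * r powr lam \<le> K * ((K / c) powr (1 / (1 - lam))) powr lam"
    using assms by (intro mult_left_mono) auto
  moreover have "c * r > 0" using assms by simp
  ultimately show ?thesis by linarith
next
  case False
  then have "((K / c) powr (1 / (1 - lam))) powr (1 - lam) \<le> r powr (1 - lam)"
    using assms by (intro powr_mono2) auto
  then have "K / c \<le> r powr (1 - lam)" using assms by (simp add: powr_powr)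
  then have "K \<le> c * r powr (1 - lam)" using assms by (simp add: field_simps)
  then have "K * r powr lam \<le> (c * r powr (1 - lam)) * r powr lam"
    using assms by (intro mult_right_mono) auto
  also have "\<dots> = c * r" using assms by (simp add: mult.assoc powr_add[symmetric])
  finally show ?thesis using assms by (smt (verit) mult_nonneg_nonneg powr_ge_zero)
qed

text \<open>The n-th term is the integral of the n-th term of the series of exp (K r^lam),
  multiplied by exp (- c r). Since lam < 1, half of the decay absorbs the growth, and M exp (- c r /
  2) bounds all partial sums.\<close>

lemma summable_Gamma_over_fact:
  fixes K c lam :: real
  assumes K: "K > 0" and lam: "0 < lam" "lam < 1" and c: "c > 0"
  shows "summable (\<lambda>n. K ^ n / fact n * (Gamma (1 + lam * real n) * c powr (- (1 + lam * real n))))"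
proof -
  define g where "g n r = K ^ n / fact n * (r powr (1 + lam * real n - 1) * exp (- c * r))" for n and r :: real
  define M where "M = exp (K * ((K / (c / 2)) powr (1 / (1 - lam))) powr lam)"
  have ig: "integrable pos_lborel (g n)" for n
    unfolding g_def using lam c by (intro integrable_mult_right gamma_integral_pos) (auto intro: add_pos_nonneg)
  have vg: "integral\<^sup>L pos_lborel (g n) = K ^ n / fact n * (Gamma (1 + lam * real n) * c powr (- (1 + lam * real n)))" for n
    unfolding g_def integral_mult_right_zero
    using lam c by (subst gamma_integral_pos(2)) (auto intro: add_pos_nonneg)
  have bd: "(\<Sum>k<n. g k r) \<le> M * (r powr (1 - 1) * exp (- (c / 2) * r))" if r: "r > 0" for n r
  proof -
    have "g k r = exp (- c * r) * ((K * r powr lam) ^ k / fact k)" for k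
      using r by (simp add: g_def power_mult_distrib powr_power mult_ac)
    then have "(\<Sum>k<n. g k r) = exp (- c * r) * (\<Sum>k<n. (K * r powr lam) ^ k / fact k)"
      by (simp add: sum_distrib_left)
    also have "(\<Sum>k<n. (K * r powr lam) ^ k / fact k) \<le> (\<Sum>k. (K * r powr lam) ^ k / fact k)"
      using K by (intro sum_le_suminf summable_exp_of_real) auto
    also have "\<dots> = exp (K * r powr lam)"
      by (simp add: exp_def scaleR_conv_of_real divide_inverse mult.commute)
    also have "exp (- c * r) * exp (K * r powr lam) \<le> exp (- c * r) * exp (c / 2 * r + K * ((K / (c / 2)) powr (1 / (1 - lam))) powr lam)"
      using powr_le_linear[OF K lam, of "c / 2" r] c r by simp
    also have "\<dots> = M * exp (- (c / 2) * r)"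
      by (simp add: M_def exp_add[symmetric] field_simps)
    finally show ?thesis using r by simp
  qed
  have i2: "integrable pos_lborel (\<lambda>r. M * (r powr (1 - 1) * exp (- (c / 2) * r)))"
    using c by (intro integrable_mult_right gamma_integral_pos) auto
  have "summable (\<lambda>n. integral\<^sup>L pos_lborel (g n))"
  proof (rule summableI_nonneg_bounded)
    show "0 \<le> integral\<^sup>L pos_lborel (g n)" for n
      using K by (intro integral_nonneg_AE AE_I2) (auto simp: g_def)
    show "(\<Sum>k<n. integral\<^sup>L pos_lborel (g k)) \<le> (\<integral>r. M * (r powr (1 - 1) * exp (- (c / 2) * r)) \<partial>pos_lborel)" for n
    proof -
      have "(\<Sum>k<n. integral\<^sup>L pos_lborel (g k)) = (\<integral>r. (\<Sum>k<n. g k r) \<partial>pos_lborel)"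
        using ig by (subst Bochner_Integration.integral_sum) auto
      also have "\<dots> \<le> (\<integral>r. M * (r powr (1 - 1) * exp (- (c / 2) * r)) \<partial>pos_lborel)"
        using ig i2 bd by (intro integral_mono Bochner_Integration.integrable_sum) auto
      finally show ?thesis .
    qed
  qed
  then show ?thesis unfolding vg .
qed


subsection \<open>The Mellin transform and the case of a first parameter below 1\<close>

text \<open>At this angle \<rho> \<theta> = pi - \<theta>, so both exponentials in the ray integral,
  in r and in s r^(-\<rho>), decay with the same constant - cos \<theta>.\<close>

lemma ray_angle:
  fixes \<rho> :: real
  assumes "0 < \<rho>" "\<rho> < 1"
  defines "\<theta> \<equiv> pi / (1 + \<rho>)"
  shows "pi / 2 < \<theta>" "\<theta> < pi" "\<rho> * \<theta> \<le> pi / 2" "cos (\<rho> * \<theta>) = - cos \<theta>" "cos \<theta> < 0"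
proof -
  show 1: "pi / 2 < \<theta>" "\<theta> < pi"
    using assms by (auto simp: \<theta>_def divide_strict_left_mono mult_less_cancel_left_pos field_simps)
  have e: "\<rho> * \<theta> = pi - \<theta>" using assms by (simp add: \<theta>_def field_simps)
  then show "\<rho> * \<theta> \<le> pi / 2" "cos (\<rho> * \<theta>) = - cos \<theta>" using 1 by auto
  show "cos \<theta> < 0" using 1 by (rule cos_obtuse_neg)
qed

text \<open>In the ray representation the s-integral is a gamma integral with rate r^(-\<rho>) cis
  (- \<rho> \<theta>). It produces \<Gamma>(z) r^(\<rho> z) times a phase, and the remaining ray
  integral is \<open>ray_rGamma\<close> with y = \<rho> z. The same exchange with norms gives the
  moment bound.\<close>

lemma reduced_wright_mellin:
  fixes \<rho> z :: real
  assumes \<rho>: "0 < \<rho>" "\<rho> < 1" and z: "z > 0"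
  defines "c \<equiv> - cos (pi / (1 + \<rho>))"
  shows "integrable pos_lborel (\<lambda>s. s powr (z - 1) * reduced_wright \<rho> (- s))"
    and "(\<integral>s. s powr (z - 1) * reduced_wright \<rho> (- s) \<partial>pos_lborel) = Gamma z * rGamma (- (\<rho> * z))"
    and "(\<integral>s. \<bar>s powr (z - 1) * reduced_wright \<rho> (- s)\<bar> \<partial>pos_lborel)
           \<le> Gamma z * c powr (- z) * (Gamma (1 + \<rho> * z) * c powr (- (1 + \<rho> * z))) / pi"
proof -
  define \<theta> where "\<theta> = pi / (1 + \<rho>)"
  note th = ray_angle[OF \<rho>, folded \<theta>_def]
  have c: "c > 0" "cos \<theta> = - c" using th(5) by (auto simp: c_def \<theta>_def)
  define k :: "real \<Rightarrow> real \<Rightarrow> complex" where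
    "k r s = of_real (s powr (z - 1)) * (exp (of_real r * cis \<theta> - of_real (s * r powr (- \<rho>)) * cis (- (\<rho> * \<theta>))) * cis \<theta>)" for r s
  have nk: "norm (k r s) = exp (- c * r) * (s powr (z - 1) * exp (- (c * r powr (- \<rho>)) * s))" for r s
    using th(4) c by (simp add: k_def norm_mult exp_add[symmetric] mult_ac)
  have kk: "k r s = (exp (of_real r * cis \<theta>) * cis \<theta>) * (of_real (s powr (z - 1)) * exp (- (of_real (r powr (- \<rho>)) * cis (- (\<rho> * \<theta>))) * of_real s))" for r s
    by (simp add: k_def exp_diff exp_minus divide_inverse mult_ac)
  have [measurable]: "case_prod k \<in> borel_measurable (pos_lborel \<Otimes>\<^sub>M pos_lborel)"
    unfolding k_def by measurable
  have rp: "(r powr (- \<rho>)) powr (- z) = r powr (1 + \<rho> * z - 1)" for r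
    by (simp add: powr_powr)
  have inner: "integrable pos_lborel (k r)" "integral\<^sup>L pos_lborel (k r) = of_real (Gamma z) * (exp (of_real r * cis \<theta>) * (of_real (r powr (\<rho> * z)) * cis (\<rho> * z * \<theta>)) * cis \<theta>)"
    "(\<integral>s. norm (k r s) \<partial>pos_lborel) = Gamma z * c powr (- z) * (r powr (1 + \<rho> * z - 1) * exp (- c * r))"
    if r: "r > 0" for r
  proof -
    have p: "Re (of_real (r powr (- \<rho>)) * cis (- (\<rho> * \<theta>))) > 0"
      using th(4) c r by simp
    note g = gamma_integral_complex_rate[OF z p]
    show "integrable pos_lborel (k r)"
      unfolding kk using g(1) by (rule integrable_mult_right)
    \<comment> \<open>The angle - \<rho> \<theta> of the rate must lie in the principal range before
      \<open>rcis_powr\<close> applies.\<close>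
    have "\<theta> > 0" "\<rho> * \<theta> < pi" using th(1,3) pi_gt_zero by linarith+
    moreover from this have "\<rho> * \<theta> > 0" using \<rho> by simp
    ultimately have "(of_real (r powr (- \<rho>)) * cis (- (\<rho> * \<theta>))) powr (of_real (- z)) = of_real (r powr (\<rho> * z)) * cis (\<rho> * z * \<theta>)"
      using r by (subst rcis_powr) (auto simp: powr_powr mult_ac)
    then show "integral\<^sup>L pos_lborel (k r) = of_real (Gamma z) * (exp (of_real r * cis \<theta>) * (of_real (r powr (\<rho> * z)) * cis (\<rho> * z * \<theta>)) * cis \<theta>)"
      unfolding kk integral_mult_right_zero g(2) by (simp add: mult_ac)
    have "c * r powr (- \<rho>) > 0" using c r by simp
    from gamma_integral_pos(2)[OF z this]
    show "(\<integral>s. norm (k r s) \<partial>pos_lborel) = Gamma z * c powr (- z) * (r powr (1 + \<rho> * z - 1) * exp (- c * r))"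
      unfolding nk integral_mult_right_zero using c by (simp add: powr_mult rp mult_ac)
  qed
  have g2: "integrable pos_lborel (\<lambda>r. Gamma z * c powr (- z) * (r powr (1 + \<rho> * z - 1) * exp (- c * r)))"
    using c \<rho> z by (intro integrable_mult_right gamma_integral_pos) (auto intro: add_pos_pos)
  have ik: "integrable (pos_lborel \<Otimes>\<^sub>M pos_lborel) (case_prod k)"
  proof (rule pos_lborel.Fubini_integrable)
    show "integrable pos_lborel (\<lambda>r. \<integral>s. norm (case_prod k (r, s)) \<partial>pos_lborel)"
      using g2 inner(3) by (subst Bochner_Integration.integrable_cong[OF refl]) auto
    show "AE r in pos_lborel. integrable pos_lborel (\<lambda>s. case_prod k (r, s))"
      using inner(1) by (intro AE_I2) auto
  qed simp
  have snd: "(\<integral>r. k r s \<partial>pos_lborel) = of_real (s powr (z - 1)) * (\<integral>r. exp (of_real r * cis \<theta> - of_real (s * r powr (- \<rho>)) * cis (- (\<rho> * \<theta>))) * cis \<theta> \<partial>pos_lborel)" for s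
    unfolding k_def integral_mult_right_zero ..
  have ImI: "Im (\<integral>r. k r s \<partial>pos_lborel) / pi = s powr (z - 1) * reduced_wright \<rho> (- s)" if "s > 0" for s
    unfolding snd using reduced_wright_ray[OF \<rho>(1) th(1-3) that] by simp
  have isnd: "integrable pos_lborel (\<lambda>s. Im (\<integral>r. k r s \<partial>pos_lborel) / pi)"
    by (intro integrable_divide integrable_Im pos_lborel.integrable_snd ik)
  show "integrable pos_lborel (\<lambda>s. s powr (z - 1) * reduced_wright \<rho> (- s))"
    using isnd ImI by (subst Bochner_Integration.integrable_cong[OF refl, where g = "\<lambda>s. Im (\<integral>r. k r s \<partial>pos_lborel) / pi"]) auto
  have "(\<integral>s. s powr (z - 1) * reduced_wright \<rho> (- s) \<partial>pos_lborel) = (\<integral>s. Im (\<integral>r. k r s \<partial>pos_lborel) / pi \<partial>pos_lborel)"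
    using ImI by (intro Bochner_Integration.integral_cong) auto
  also have "\<dots> = Im (\<integral>s. (\<integral>r. k r s \<partial>pos_lborel) \<partial>pos_lborel) / pi"
    using integral_Im[OF pos_lborel.integrable_snd[OF ik]] by simp
  also have "(\<integral>s. (\<integral>r. k r s \<partial>pos_lborel) \<partial>pos_lborel) = (\<integral>r. (\<integral>s. k r s \<partial>pos_lborel) \<partial>pos_lborel)"
    by (rule pos_lborel.Fubini_integral[OF ik])
  also have "\<dots> = (\<integral>r. of_real (Gamma z) * (exp (of_real r * cis \<theta>) * (of_real (r powr (\<rho> * z)) * cis (\<rho> * z * \<theta>)) * cis \<theta>) \<partial>pos_lborel)"
    using inner(2) by (intro Bochner_Integration.integral_cong) auto
  also have "Im \<dots> / pi = Gamma z * rGamma (- (\<rho> * z))"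
  proof -
    have "\<rho> * z > -1" using \<rho> z by (smt (verit) mult_pos_pos)
    from ray_rGamma(2)[OF this th(1,2)] show ?thesis
      unfolding integral_mult_right_zero by simp
  qed
  finally show "(\<integral>s. s powr (z - 1) * reduced_wright \<rho> (- s) \<partial>pos_lborel) = Gamma z * rGamma (- (\<rho> * z))" .
  have inorm: "integrable (pos_lborel \<Otimes>\<^sub>M pos_lborel) (\<lambda>(r, s). norm (k r s))"
    using integrable_norm[OF ik] by (simp add: case_prod_beta')
  have "(\<integral>s. \<bar>s powr (z - 1) * reduced_wright \<rho> (- s)\<bar> \<partial>pos_lborel) = (\<integral>s. \<bar>Im (\<integral>r. k r s \<partial>pos_lborel) / pi\<bar> \<partial>pos_lborel)"
    using ImI by (intro Bochner_Integration.integral_cong) auto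
  also have "\<dots> \<le> (\<integral>s. (\<integral>r. norm (k r s) \<partial>pos_lborel) / pi \<partial>pos_lborel)"
  proof (rule integral_mono)
    show "integrable pos_lborel (\<lambda>s. \<bar>Im (\<integral>r. k r s \<partial>pos_lborel) / pi\<bar>)"
      using isnd by (rule integrable_abs)
    show "integrable pos_lborel (\<lambda>s. (\<integral>r. norm (k r s) \<partial>pos_lborel) / pi)"
      by (intro integrable_divide pos_lborel.integrable_snd inorm)
    show "\<bar>Im (\<integral>r. k r s \<partial>pos_lborel) / pi\<bar> \<le> (\<integral>r. norm (k r s) \<partial>pos_lborel) / pi" for s
      using order_trans[OF abs_Im_le_cmod integral_norm_bound, of pos_lborel "\<lambda>r. k r s"]
      by (simp add: divide_right_mono)
  qed
  also have "\<dots> = (\<integral>r. (\<integral>s. norm (k r s) \<partial>pos_lborel) \<partial>pos_lborel) / pi"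
    using pos_lborel.Fubini_integral[OF inorm] by simp
  also have "(\<integral>r. (\<integral>s. norm (k r s) \<partial>pos_lborel) \<partial>pos_lborel) = (\<integral>r. Gamma z * c powr (- z) * (r powr (1 + \<rho> * z - 1) * exp (- c * r)) \<partial>pos_lborel)"
    using inner(3) by (intro Bochner_Integration.integral_cong) auto
  also have "\<dots> = Gamma z * c powr (- z) * (Gamma (1 + \<rho> * z) * c powr (- (1 + \<rho> * z)))"
    unfolding integral_mult_right_zero using c \<rho> z by (subst gamma_integral_pos(2)) (auto intro: add_pos_pos)
  finally show "(\<integral>s. \<bar>s powr (z - 1) * reduced_wright \<rho> (- s)\<bar> \<partial>pos_lborel)
           \<le> Gamma z * c powr (- z) * (Gamma (1 + \<rho> * z) * c powr (- (1 + \<rho> * z))) / pi" .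
qed

text \<open>Each power of s in the second series is integrated by the Mellin transform of the first
  factor: \<Gamma>(\<rho>2 n) cancels, and 1/\<Gamma>(- \<rho>1 \<rho>2 n) remains as
  coefficient.\<close>

lemma reduced_wright_convolution_less_one:
  fixes \<rho>1 \<rho>2 x :: real
  assumes \<rho>1: "0 < \<rho>1" "\<rho>1 < 1" and \<rho>2: "0 < \<rho>2" "\<rho>1 * \<rho>2 < 1" and x: "x > 0"
  shows "integrable pos_lborel (\<lambda>s. reduced_wright \<rho>1 (- s) * reduced_wright \<rho>2 (- (x * s powr \<rho>2)) / s)"
    and "reduced_wright (- (\<rho>1 * \<rho>2)) (- x) =
      (\<integral>s. reduced_wright \<rho>1 (- s) * reduced_wright \<rho>2 (- (x * s powr \<rho>2)) / s \<partial>pos_lborel)"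
proof -
  define c where "c = - cos (pi / (1 + \<rho>1))"
  have c: "c > 0" using ray_angle(5)[OF \<rho>1] by (simp add: c_def)
  \<comment> \<open>\<open>Suc n\<close> because the Wright series starts at 1. The factor 1/s of
    the integrand makes the power s^(q n - 1), which is the Mellin kernel at
    \<open>q n\<close>.\<close>
  define q where "q n = \<rho>2 * real (Suc n)" for n
  have q: "q n > 0" for n using \<rho>2 by (simp add: q_def)
  define C where "C n = (- x) ^ Suc n / fact (Suc n) * rGamma (q n)" for n
  define t where "t n s = C n * (s powr (q n - 1) * reduced_wright \<rho>1 (- s))" for n s
  note mel = reduced_wright_mellin[OF \<rho>1 q, folded c_def]
  have rG: "rGamma (q n) * Gamma (q n) = 1" "rGamma (q n) > 0" for n
    using Gamma_real_pos[OF q[of n]] by (auto simp: rGamma_inverse_Gamma simp del: Gamma_eq_zero_iff)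
  have int: "integrable pos_lborel (t n)" for n
    unfolding t_def using mel(1) by (intro integrable_mult_right)
  have val: "integral\<^sup>L pos_lborel (t n) = (- x) ^ Suc n / fact (Suc n) * rGamma (- (\<rho>1 * \<rho>2) * real (Suc n))" for n
  proof -
    have "integral\<^sup>L pos_lborel (t n) = C n * (Gamma (q n) * rGamma (- (\<rho>1 * q n)))"
      unfolding t_def integral_mult_right_zero mel(2) ..
    also have "\<dots> = (- x) ^ Suc n / fact (Suc n) * (rGamma (q n) * Gamma (q n)) * rGamma (- (\<rho>1 * q n))"
      by (simp only: C_def mult_ac)
    also have "- (\<rho>1 * q n) = - (\<rho>1 * \<rho>2) * real (Suc n)" by (simp add: q_def)
    finally show ?thesis unfolding rG by simp
  qed
  have sums_t: "(\<lambda>n. t n s) sums (reduced_wright \<rho>1 (- s) * reduced_wright \<rho>2 (- (x * s powr \<rho>2)) / s)"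
    and summ_t: "summable (\<lambda>n. norm (t n s))" if s: "s > 0" for s
  proof -
    \<comment> \<open>Any angle between pi/2 and pi serves: the wedge formula is invoked for the
      convergence of the second series, and it allows \<rho>2 \<ge> 1.\<close>
    have th: "pi / 2 < 2 * pi / 3" "2 * pi / 3 < pi" by auto
    have tn: "t n s = (- (x * s powr \<rho>2)) ^ Suc n / fact (Suc n) * rGamma (\<rho>2 * real (Suc n)) * (reduced_wright \<rho>1 (- s) / s)" for n
    proof -
      have "s powr (q n - 1) = (s powr \<rho>2) ^ Suc n / s"
        using s by (simp only: q_def powr_diff powr_power mult.commute[of \<rho>2]) simp
      moreover have "(- (x * s powr \<rho>2)) ^ Suc n = (- x) ^ Suc n * (s powr \<rho>2) ^ Suc n"
        by (metis mult_minus_left power_mult_distrib)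
      ultimately show ?thesis by (simp add: t_def C_def q_def mult_ac del: power_Suc fact_Suc of_nat_Suc)
    qed
    show "(\<lambda>n. t n s) sums (reduced_wright \<rho>1 (- s) * reduced_wright \<rho>2 (- (x * s powr \<rho>2)) / s)"
      using sums_mult2[OF summable_sums[OF sums_summable[OF reduced_wright_sums_wedge[OF \<rho>2(1) th, of "- (x * s powr \<rho>2)"]]], of "reduced_wright \<rho>1 (- s) / s"]
      unfolding tn by (simp add: reduced_wright_def mult_ac)
    \<comment> \<open>Since \<open>rGamma (q n)\<close> is positive, the norms form the Wright
      series at the positive argument x s^\<rho>2.\<close>
    have "norm (t n s) = (x * s powr \<rho>2) ^ Suc n / fact (Suc n) * rGamma (\<rho>2 * real (Suc n)) * \<bar>reduced_wright \<rho>1 (- s) / s\<bar>" for n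
      unfolding tn using x s rG(2)[of n] by (simp add: abs_mult power_abs q_def del: power_Suc fact_Suc of_nat_Suc)
    then show "summable (\<lambda>n. norm (t n s))"
      using summable_mult2[OF sums_summable[OF reduced_wright_sums_wedge[OF \<rho>2(1) th, of "x * s powr \<rho>2"]], of "\<bar>reduced_wright \<rho>1 (- s) / s\<bar>"]
      by simp
  qed
  have sni: "summable (\<lambda>n. \<integral>s. norm (t n s) \<partial>pos_lborel)"
  proof (rule summable_comparison_test')
    \<comment> \<open>After \<Gamma>(q n) cancels, the moment bound leaves
      \<open>g (Suc n) / pi\<close>, and \<open>summable_Gamma_over_fact\<close> applies with K = x
      c^(-\<rho>2) and lam = \<rho>1 \<rho>2.\<close>
    define g where "g n = (x * c powr (- \<rho>2)) ^ n / fact n * (Gamma (1 + \<rho>1 * \<rho>2 * real n) * c powr (- (1 + \<rho>1 * \<rho>2 * real n)))" for n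
    have "summable g"
      unfolding g_def using \<rho>1 \<rho>2 x c by (intro summable_Gamma_over_fact) auto
    then have "summable (\<lambda>n. g (Suc n))" by (simp add: summable_Suc_iff)
    then show "summable (\<lambda>n. g (Suc n) / pi)" by (rule summable_divide)
    show "norm (\<integral>s. norm (t n s) \<partial>pos_lborel) \<le> g (Suc n) / pi" for n
    proof -
      have "(\<integral>s. norm (t n s) \<partial>pos_lborel) = \<bar>C n\<bar> * (\<integral>s. \<bar>s powr (q n - 1) * reduced_wright \<rho>1 (- s)\<bar> \<partial>pos_lborel)"
        unfolding t_def real_norm_def abs_mult[of "C n"] integral_mult_right_zero ..
      also have "\<dots> \<le> \<bar>C n\<bar> * (Gamma (q n) * c powr (- q n) * (Gamma (1 + \<rho>1 * q n) * c powr (- (1 + \<rho>1 * q n))) / pi)"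
        by (intro mult_left_mono mel(3)) auto
      also have "\<bar>C n\<bar> = x ^ Suc n / fact (Suc n) * rGamma (q n)"
        using x rG(2)[of n] by (simp add: C_def abs_mult power_abs del: power_Suc fact_Suc)
      also have "c powr (- q n) = (c powr (- \<rho>2)) ^ Suc n"
        using c by (simp add: powr_power q_def mult_ac del: power_Suc)
      also have "\<rho>1 * q n = \<rho>1 * \<rho>2 * real (Suc n)" by (simp add: q_def)
      also have "x ^ Suc n / fact (Suc n) * rGamma (q n) * (Gamma (q n) * (c powr (- \<rho>2)) ^ Suc n * (Gamma (1 + \<rho>1 * \<rho>2 * real (Suc n)) * c powr (- (1 + \<rho>1 * \<rho>2 * real (Suc n)))) / pi)
        = (rGamma (q n) * Gamma (q n)) * g (Suc n) / pi"
        by (simp add: g_def power_mult_distrib mult_ac del: power_Suc fact_Suc of_nat_Suc)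
      finally show ?thesis unfolding rG by simp
    qed
  qed
  have ae: "AE s in pos_lborel. summable (\<lambda>n. norm (t n s))"
    using summ_t by (intro AE_I2) auto
  have eq: "(\<Sum>n. t n s) = reduced_wright \<rho>1 (- s) * reduced_wright \<rho>2 (- (x * s powr \<rho>2)) / s" if "s \<in> space pos_lborel" for s
    using sums_t[of s] that by (simp add: sums_iff)
  show "integrable pos_lborel (\<lambda>s. reduced_wright \<rho>1 (- s) * reduced_wright \<rho>2 (- (x * s powr \<rho>2)) / s)"
    using integrable_suminf[OF int ae sni] by (subst Bochner_Integration.integrable_cong[OF refl eq[symmetric]]) auto
  have "(\<integral>s. reduced_wright \<rho>1 (- s) * reduced_wright \<rho>2 (- (x * s powr \<rho>2)) / s \<partial>pos_lborel) = (\<integral>s. (\<Sum>n. t n s) \<partial>pos_lborel)"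
    by (intro Bochner_Integration.integral_cong refl eq[symmetric])
  also have "\<dots> = (\<Sum>n. integral\<^sup>L pos_lborel (t n))"
    by (rule integral_suminf[OF int ae sni])
  finally show "reduced_wright (- (\<rho>1 * \<rho>2)) (- x) =
      (\<integral>s. reduced_wright \<rho>1 (- s) * reduced_wright \<rho>2 (- (x * s powr \<rho>2)) / s \<partial>pos_lborel)"
    by (simp only: val reduced_wright_def)
qed


subsection \<open>The Bessel case\<close>

text \<open>A bridge to the change of variables theorems, which speak of absolute integrability with
  respect to \<open>lebesgue\<close>; completing the measure does not alter integrals of Borel
  functions.\<close>

lemma
  fixes f :: "real \<Rightarrow> 'a::euclidean_space"
  assumes "f \<in> borel_measurable pos_lborel"
  shows integrable_pos_lborel_iff_absolutely_integrable:
      "integrable pos_lborel f \<longleftrightarrow> f absolutely_integrable_on {0<..}"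
    and integral_pos_lborel_eq_lebesgue:
      "integral\<^sup>L pos_lborel f = (LINT x:{0<..}|lebesgue. f x)"
proof -
  have "(\<lambda>x. indicator {0<..} x *\<^sub>R f x) \<in> borel_measurable lborel"
    using assms unfolding pos_lborel_def by (subst (asm) borel_measurable_restrict_space_iff) auto
  then show "integrable pos_lborel f \<longleftrightarrow> f absolutely_integrable_on {0<..}"
    "integral\<^sup>L pos_lborel f = (LINT x:{0<..}|lebesgue. f x)"
    unfolding integrable_pos_lborel_iff integral_pos_lborel set_integrable_def set_lebesgue_integral_def
    by (simp_all add: integrable_completion integral_completion)
qed

text \<open>The substitution r = s/v. In the ray integral for \<phi>(\<rho>, 0; -x s^\<rho>) it
  leaves s only in exp (s cis \<theta> / v) and in the Jacobian, so that s can be integrated out as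
  a Laplace variable.\<close>

lemma pos_lborel_reciprocal_substitution:
  fixes g :: "real \<Rightarrow> real"
  assumes g: "integrable pos_lborel g" and s: "s > 0"
  shows "(\<integral>r. g r \<partial>pos_lborel) = (\<integral>v. s / v\<^sup>2 * g (s / v) \<partial>pos_lborel)"
proof -
  have gm [measurable]: "g \<in> borel_measurable pos_lborel" using g by simp
  have [measurable]: "(\<lambda>v. s / v) \<in> pos_lborel \<rightarrow>\<^sub>M pos_lborel"
  proof -
    have "(\<lambda>v. s / v) \<in> pos_lborel \<rightarrow>\<^sub>M restrict_space lborel {0<..}"
      using s by (intro measurable_restrict_space2) auto
    then show ?thesis by (simp add: pos_lborel_def)
  qed
  have m: "(\<lambda>v. s / v\<^sup>2 * g (s / v)) \<in> borel_measurable pos_lborel"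
    by measurable
  have im: "(\<lambda>v. s / v) ` {0<..} = {0<..}"
    using s by (auto simp: image_iff intro!: bexI[of _ "s / x" for x])
  have "(\<lambda>v. \<bar>- s / v\<^sup>2\<bar> * g (s / v)) absolutely_integrable_on {0<..} \<and>
      integral {0<..} (\<lambda>v. \<bar>- s / v\<^sup>2\<bar> * g (s / v)) = integral {0<..} g"
  proof (rule has_absolute_integral_change_of_variables_1'[where f = g and g = "\<lambda>v. s / v" and g' = "\<lambda>v. - s / v\<^sup>2", THEN iffD2])
    show "((\<lambda>v. s / v) has_field_derivative - s / x\<^sup>2) (at x within {0<..})" if "x \<in> {0<..}" for x
      using that by (auto intro!: derivative_eq_intros simp: power2_eq_square)
    show "inj_on (\<lambda>v. s / v) {0<..}" using s by (auto simp: inj_on_def)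
    show "g absolutely_integrable_on (\<lambda>v. s / v) ` {0<..} \<and> integral ((\<lambda>v. s / v) ` {0<..}) g = integral {0<..} g"
      using g unfolding im by (simp add: integrable_pos_lborel_iff_absolutely_integrable)
  qed simp
  then have *: "(\<lambda>v. s / v\<^sup>2 * g (s / v)) absolutely_integrable_on {0<..}"
      "integral {0<..} (\<lambda>v. s / v\<^sup>2 * g (s / v)) = integral {0<..} g"
    using s by simp_all
  show ?thesis
    unfolding integral_pos_lborel_eq_lebesgue[OF gm] integral_pos_lborel_eq_lebesgue[OF m]
    using set_lebesgue_integral_eq_integral(2)[OF *(1)] *(2) g
      set_lebesgue_integral_eq_integral(2)[of "{0<..}" g]
    by (simp add: integrable_pos_lborel_iff_absolutely_integrable)
qed

text \<open>Substituting v = u^(1/\<rho>) turns the integrand into a gamma density with parameter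
  1/\<rho>.\<close>

lemma integrable_exp_neg_powr:
  fixes \<rho> k :: real
  assumes "\<rho> > 0" "k > 0"
  shows "integrable pos_lborel (\<lambda>v. exp (- (k * v powr \<rho>)))"
proof -
  have im: "(\<lambda>u. u powr (1 / \<rho>)) ` {0<..} = {0<..}"
  proof safe
    fix v :: real assume "v > 0"
    then show "v \<in> (\<lambda>u. u powr (1 / \<rho>)) ` {0<..}"
      using assms by (intro image_eqI[of _ _ "v powr \<rho>"]) (auto simp: powr_powr)
  qed auto
  have "(\<lambda>v. exp (- (k * v powr \<rho>))) absolutely_integrable_on (\<lambda>u. u powr (1 / \<rho>)) ` {0<..} \<longleftrightarrow>
     (\<lambda>u. \<bar>1 / \<rho> * u powr (1 / \<rho> - 1)\<bar> *\<^sub>R exp (- (k * (u powr (1 / \<rho>)) powr \<rho>))) absolutely_integrable_on {0<..}"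
  proof (rule absolutely_integrable_change_of_variables_real)
    show "((\<lambda>u. u powr (1 / \<rho>)) has_field_derivative 1 / \<rho> * x powr (1 / \<rho> - 1)) (at x within {0<..})" if "x \<in> {0<..}" for x
      using that assms by (auto intro!: derivative_eq_intros simp: powr_diff)
    show "inj_on (\<lambda>u. u powr (1 / \<rho>)) {0<..}"
    proof (rule inj_onI)
      fix x y :: real assume "x \<in> {0<..}" "y \<in> {0<..}" "x powr (1 / \<rho>) = y powr (1 / \<rho>)"
      then have "(x powr (1 / \<rho>)) powr \<rho> = (y powr (1 / \<rho>)) powr \<rho>" "x > 0" "y > 0" by simp_all
      then show "x = y" using assms(1) unfolding powr_powr by simp
    qed
  qed simp
  also have "\<dots> \<longleftrightarrow> (\<lambda>u. 1 / \<rho> * (u powr (1 / \<rho> - 1) * exp (- k * u))) absolutely_integrable_on {0<..}"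
    using assms by (intro set_integrable_cong refl) (auto simp: powr_powr abs_mult)
  also have "\<dots>"
    using gamma_integral_pos(1)[of "1 / \<rho>" k] assms
    by (subst integrable_pos_lborel_iff_absolutely_integrable[symmetric]) (auto intro!: integrable_mult_right)
  finally show ?thesis
    unfolding im by (subst integrable_pos_lborel_iff_absolutely_integrable) auto
qed

section \<open>Growth and Laplace transform of \<phi>(1, 0; -s)\<close>

lemma reduced_wright_one:
  "reduced_wright 1 z = (\<Sum>n. z ^ Suc n / (fact (Suc n) * fact n))"
proof -
  have "rGamma (1 * real (Suc n)) = 1 / fact n" for n
    using Gamma_fact[of n, where 'a = real] by (simp add: rGamma_inverse_Gamma divide_inverse add.commute)
  then show ?thesis by (simp add: reduced_wright_def del: fact_Suc)
qed

text \<open>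
  With \<open>J s = J\<^sub>0 (2 \<surd>s)\<close> one has \<open>\<phi>(1, 0; -s) = s J' s\<close> and \<open>(s J')' = - J\<close>, so the energy
  \<open>J\<^sup>2 + s J'\<^sup>2\<close> has derivative \<open>- J'\<^sup>2\<close> and \<open>\<bar>J\<bar> \<le> 1\<close>.
\<close>

lemma abs_reduced_wright_one_le:
  assumes "s \<ge> 0"
  shows "\<bar>reduced_wright 1 (- s)\<bar> \<le> s"
proof -
  \<comment> \<open>The Taylor coefficients of J and, in \<open>a\<close>, those of \<phi>(1, 0;
    -s). With \<open>w\<close> for J' and \<open>y\<close> for \<phi>(1, 0; -s), the relations
    \<open>da\<close> and \<open>dc\<close> between them say y' = - J and y = s w.\<close>
  define c :: "nat \<Rightarrow> real" where "c n = (- 1) ^ n / (fact n * fact n)" for n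
  define a :: "nat \<Rightarrow> real" where "a n = (case n of 0 \<Rightarrow> 0 | Suc m \<Rightarrow> (- 1) ^ n / (fact n * fact m))" for n
  have bd: "norm (b * s ^ n) \<le> \<bar>s\<bar> ^ n / fact n" if "\<bar>b\<bar> \<le> 1 / fact n" for b s :: real and n
    using mult_right_mono[OF that, of "\<bar>s\<bar> ^ n"] by (simp add: abs_mult power_abs)
  have c1: "\<bar>c n\<bar> \<le> 1 / fact n" for n
    by (simp add: c_def abs_mult power_abs divide_simps)
  have a1: "\<bar>a n\<bar> \<le> 1 / fact n" for n
    by (auto simp: a_def abs_mult power_abs divide_simps split: nat.split)
  have sc: "summable (\<lambda>n. c n * s ^ n)" for s
    by (rule summable_comparison_test'[OF summable_exp_of_real[of "\<bar>s\<bar>"] bd[OF c1]])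
  have sa: "summable (\<lambda>n. a n * s ^ n)" for s
    by (rule summable_comparison_test'[OF summable_exp_of_real[of "\<bar>s\<bar>"] bd[OF a1]])
  have da: "diffs a n = - c n" for n
    by (simp add: diffs_def a_def c_def del: of_nat_Suc)
  have dc: "diffs c n = a (Suc n)" for n
    by (simp add: diffs_def a_def c_def del: of_nat_Suc)
  define J where "J s = (\<Sum>n. c n * s ^ n)" for s
  define w where "w s = (\<Sum>n. diffs c n * s ^ n)" for s
  define y where "y s = (\<Sum>n. a n * s ^ n)" for s
  have dJ: "(J has_real_derivative w s) (at s)" for s
    unfolding J_def w_def by (rule termdiffs_strong_converges_everywhere[OF sc])
  \<comment> \<open>Existence of w' is enough: the equation \<open>rel\<close> for it follows by
    differentiating s w = y in two ways.\<close>
  have "\<exists>D. (w has_real_derivative D) (at s)" for s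
    unfolding w_def using termdiffs_strong_converges_everywhere[OF termdiff_converges_all[OF sc]] by blast
  then obtain w' where dw: "(w has_real_derivative w' s) (at s)" for s by metis
  have dy: "(y has_real_derivative - J s) (at s)" for s
  proof -
    have "(\<Sum>n. diffs a n * s ^ n) = - J s"
      unfolding da J_def using suminf_minus[OF sc[of s]] by simp
    then show ?thesis
      using termdiffs_strong_converges_everywhere[OF sa, of s] by (simp add: y_def[abs_def])
  qed
  have yw: "y s = s * w s" for s
  proof -
    have "y s = a 0 + (\<Sum>n. a (Suc n) * s ^ Suc n)"
      using suminf_split_head[OF sa[of s]] by (simp add: y_def)
    also have "(\<Sum>n. a (Suc n) * s ^ Suc n) = s * w s"
      unfolding w_def using suminf_mult[OF termdiff_converges_all[OF sc, of s], of s]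
      by (simp add: dc mult_ac)
    finally show ?thesis by (simp add: a_def)
  qed
  have rel: "w s + s * w' s = - J s" for s
  proof -
    have "((\<lambda>s. s * w s) has_real_derivative w s + s * w' s) (at s)"
      by (auto intro!: derivative_eq_intros dw)
    with dy[of s] show ?thesis
      unfolding yw[abs_def] by (rule DERIV_unique[rotated])
  qed
  have J1: "\<bar>J s\<bar> \<le> 1" if "s \<ge> 0" for s
  proof -
    have "(J s)\<^sup>2 + s * (w s)\<^sup>2 \<le> (J 0)\<^sup>2 + 0 * (w 0)\<^sup>2"
    proof (rule DERIV_nonpos_imp_nonincreasing[OF that])
      fix x :: real
      have "((\<lambda>s. (J s)\<^sup>2 + s * (w s)\<^sup>2) has_real_derivative
          2 * J x * w x + ((w x)\<^sup>2 + x * (2 * w x * w' x))) (at x)"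
        by (auto intro!: derivative_eq_intros dJ dw)
      moreover have "2 * J x * w x + ((w x)\<^sup>2 + x * (2 * w x * w' x)) = - (w x)\<^sup>2"
      proof -
        have "x * w' x = - J x - w x" using rel[of x] by linarith
        then have "x * (2 * w x * w' x) = 2 * w x * (- J x - w x)" by (metis mult.left_commute)
        then show ?thesis by (simp add: power2_eq_square algebra_simps)
      qed
      ultimately show "\<exists>y. ((\<lambda>s. (J s)\<^sup>2 + s * (w s)\<^sup>2) has_real_derivative y) (at x) \<and> y \<le> 0"
        by (metis neg_le_0_iff_le zero_le_power2)
    qed
    moreover have "J 0 = 1" unfolding J_def powser_zero by (simp add: c_def)
    moreover have "s * (w s)\<^sup>2 \<ge> 0" using that by simp
    ultimately have "(J s)\<^sup>2 \<le> 1\<^sup>2" by simp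
    then show ?thesis by (simp add: abs_square_le_1)
  qed
  have "\<bar>y s\<bar> \<le> s"
  proof (cases "s = 0")
    case False
    then have "s > 0" using assms by simp
    \<comment> \<open>The mean value theorem with y' = - J and y 0 = 0 converts the bound on J into
      linear growth.\<close>
    then obtain u where "0 < u" "y s - y 0 = (s - 0) * - J u"
      using MVT2[of 0 s y "\<lambda>s. - J s"] dy by auto
    then have "\<bar>y s\<bar> = s * \<bar>J u\<bar>" using \<open>s > 0\<close> yw[of 0] by (simp add: abs_mult)
    also have "\<dots> \<le> s * 1" using J1[of u] \<open>0 < u\<close> assms by (intro mult_left_mono) auto
    finally show ?thesis by simp
  qed (simp add: yw)
  moreover have "y s = reduced_wright 1 (- s)"
  proof -
    have "y s = (\<Sum>n. a (Suc n) * s ^ Suc n)"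
      using suminf_split_head[OF sa[of s]] by (simp add: y_def a_def)
    also have "\<dots> = reduced_wright 1 (- s)"
      unfolding reduced_wright_one
      by (intro suminf_cong) (simp add: a_def power_minus[of s] del: fact_Suc)
    finally show ?thesis .
  qed
  ultimately show ?thesis by simp
qed

text \<open>Termwise, s^(n + 1) integrates to (n + 1)! / p^(n + 2); this cancels one of the two
  factorials and leaves the exponential series at -1/p. The integrated norms form such a series at 1
  / Re p.\<close>

lemma reduced_wright_one_laplace:
  fixes p :: complex
  assumes p: "Re p > 0"
  shows "integrable pos_lborel (\<lambda>s. of_real (reduced_wright 1 (- s)) * exp (- p * of_real s))"
    and "(\<integral>s. of_real (reduced_wright 1 (- s)) * exp (- p * of_real s) \<partial>pos_lborel) = - exp (- inverse p) / p\<^sup>2"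
proof -
  have p0: "p \<noteq> 0" using p by auto
  define C where "C n = (- 1) ^ Suc n / (fact (Suc n) * fact n :: real)" for n
  define t where "t n s = of_real (C n) * (of_real (s powr (real (n + 2) - 1)) * exp (- p * of_real s))" for n s
  have pw: "s powr (real (n + 2) - 1) = s ^ Suc n" if "s > 0" for s n
    using that by (subst powr_realpow[symmetric]) auto
  note g = gamma_integral_complex_rate[OF _ p]
  have int: "integrable pos_lborel (t n)" for n
    unfolding t_def by (intro integrable_mult_right g) auto
  have gf: "Gamma (real (n + 2)) = fact (Suc n)" for n
    using Gamma_fact[of "Suc n", where 'a = real] by (simp add: add_ac)
  have val: "integral\<^sup>L pos_lborel (t n) = - (inverse p)\<^sup>2 * ((- inverse p) ^ n / fact n)" for n
  proof -
    have "integral\<^sup>L pos_lborel (t n) = of_real (C n) * (of_real (fact (Suc n)) * p powr (- of_real (real (n + 2))))"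
      unfolding t_def integral_mult_right_zero by (subst g(2)) (simp, simp only: gf)
    also have "p powr (- of_real (real (n + 2))) = inverse p ^ (n + 2)"
    proof -
      have "p powr of_nat (n + 2) = p ^ (n + 2)" using p0 powr_nat'[of p "n + 2"] by simp
      then show ?thesis by (simp only: powr_minus of_real_of_nat_eq power_inverse)
    qed
    also have "of_real (C n) * (of_real (fact (Suc n)) * inverse p ^ (n + 2)) = - (inverse p)\<^sup>2 * ((- inverse p) ^ n / fact n)"
    proof -
      have "C n * fact (Suc n) = - ((- 1) ^ n / fact n)" by (simp add: C_def del: fact_Suc)
      then have "of_real (C n) * (of_real (fact (Suc n)) * inverse p ^ (n + 2)) = of_real (- ((- 1) ^ n / fact n)) * inverse p ^ (n + 2)"
        by (metis mult.assoc of_real_mult)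
      then show ?thesis
        unfolding power_minus[of "inverse p"] by (simp add: power2_eq_square mult_ac)
    qed
    finally show ?thesis .
  qed
  have nt: "norm (t n s) = \<bar>C n\<bar> * (s powr (real (n + 2) - 1) * exp (- Re p * s))" for n s
    by (simp add: t_def norm_mult)
  have vn: "(\<integral>s. norm (t n s) \<partial>pos_lborel) = (inverse (Re p))\<^sup>2 * (inverse (Re p) ^ n / fact n)" for n
  proof -
    have "(\<integral>s. norm (t n s) \<partial>pos_lborel) = \<bar>C n\<bar> * (fact (Suc n) * Re p powr (- real (n + 2)))"
      unfolding nt integral_mult_right_zero using p by (subst gamma_integral_pos(2)) (simp, simp, simp only: gf)
    also have "Re p powr (- real (n + 2)) = inverse (Re p) ^ (n + 2)"
      using p powr_realpow[of "Re p" "n + 2"] by (simp only: powr_minus power_inverse)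
    also have "\<bar>C n\<bar> = 1 / (fact (Suc n) * fact n)"
      by (simp add: C_def abs_mult power_abs del: power_Suc fact_Suc)
    finally show ?thesis by (simp add: power2_eq_square mult_ac del: fact_Suc)
  qed
  have sn: "summable (\<lambda>n. \<integral>s. norm (t n s) \<partial>pos_lborel)"
    unfolding vn by (intro summable_mult summable_exp_of_real)
  have sC: "summable (\<lambda>n. K ^ Suc n / (fact (Suc n) * fact n))" for K :: real
  proof (rule summable_comparison_test')
    show "summable (\<lambda>n. \<bar>K\<bar> ^ Suc n / fact (Suc n))"
      using summable_exp_of_real[of "\<bar>K\<bar>"] by (subst summable_Suc_iff)
    show "norm (K ^ Suc n / (fact (Suc n) * fact n)) \<le> \<bar>K\<bar> ^ Suc n / fact (Suc n)" for n
      by (auto simp: abs_mult power_abs del: power_Suc fact_Suc intro!: divide_left_mono)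
  qed
  have tt: "t n s = of_real ((- s) ^ Suc n / (fact (Suc n) * fact n)) * exp (- p * of_real s)" if "s > 0" for n s
    unfolding t_def pw[OF that] C_def power_minus[of s] by (simp del: power_Suc fact_Suc)
  have ae: "AE s in pos_lborel. summable (\<lambda>n. norm (t n s))"
  proof (rule AE_I2)
    fix s assume "s \<in> space pos_lborel"
    then have s: "s > 0" by simp
    show "summable (\<lambda>n. norm (t n s))"
      using summable_mult2[OF sC[of s], of "exp (- Re p * s)"] s
      unfolding tt[OF s] norm_mult norm_of_real abs_divide power_abs abs_minus_cancel by simp
  qed
  have eq: "(\<Sum>n. t n s) = of_real (reduced_wright 1 (- s)) * exp (- p * of_real s)" if "s \<in> space pos_lborel" for s
  proof -
    have s: "s > 0" using that by simp
    have "(\<lambda>n. of_real ((- s) ^ Suc n / (fact (Suc n) * fact n)) * exp (- p * of_real s)) sums (of_real (reduced_wright 1 (- s)) * exp (- p * of_real s))"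
      unfolding reduced_wright_one by (intro sums_mult2 sums_of_real summable_sums sC)
    then show ?thesis unfolding tt[OF s] by (simp only: sums_iff)
  qed
  show "integrable pos_lborel (\<lambda>s. of_real (reduced_wright 1 (- s)) * exp (- p * of_real s))"
    using integrable_suminf[OF int ae sn] by (subst Bochner_Integration.integrable_cong[OF refl eq[symmetric]]) auto
  have "(\<integral>s. of_real (reduced_wright 1 (- s)) * exp (- p * of_real s) \<partial>pos_lborel) = (\<integral>s. (\<Sum>n. t n s) \<partial>pos_lborel)"
    by (intro Bochner_Integration.integral_cong refl eq[symmetric])
  also have "\<dots> = (\<Sum>n. integral\<^sup>L pos_lborel (t n))"
    by (rule integral_suminf[OF int ae sn])
  also have "\<dots> = - (inverse p)\<^sup>2 * exp (- inverse p)"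
  proof -
    have "(\<lambda>n. (- inverse p) ^ n / fact n) sums exp (- inverse p)"
      using exp_converges[of "- inverse p"] by (simp add: scaleR_conv_of_real divide_inverse mult_ac)
    from sums_mult[OF this, of "- (inverse p)\<^sup>2"] show ?thesis
      unfolding val by (simp only: sums_iff)
  qed
  finally show "(\<integral>s. of_real (reduced_wright 1 (- s)) * exp (- p * of_real s) \<partial>pos_lborel) = - exp (- inverse p) / p\<^sup>2"
    by (simp add: field_simps power2_eq_square)
qed


section \<open>The ray integral for negative parameter and the convolution with \<rho>1 = 1\<close>

text \<open>Expanding in powers of x turns each term into \<open>ray_rGamma\<close> with y = \<rho>
  n. As \<rho> < 1, the decay of exp (v cis \<theta>) outweighs exp (x v^\<rho>), and the integrated
  norms are summable.\<close>

lemma reduced_wright_negative_ray: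
  fixes \<rho> x \<theta> :: real
  assumes \<rho>: "0 < \<rho>" "\<rho> < 1" and \<theta>: "pi / 2 < \<theta>" "\<theta> < pi" and x: "x > 0"
  shows "Im (\<integral>v. exp (of_real v * cis \<theta> - of_real (x * v powr \<rho>) * cis (\<rho> * \<theta>)) * cis \<theta> \<partial>pos_lborel)
    = pi * reduced_wright (- \<rho>) (- x)"
proof -
  have c: "cos \<theta> < 0" using \<theta> by (rule cos_obtuse_neg)
  have y: "\<rho> * real n > -1" for n using \<rho> by (smt (verit) mult_nonneg_nonneg of_nat_0_le_iff)
  define T where "T n v = of_real ((- x) ^ n / fact n) * (exp (of_real v * cis \<theta>) * (of_real (v powr (\<rho> * real n)) * cis (\<rho> * real n * \<theta>)) * cis \<theta>)" for n v
  have int: "integrable pos_lborel (T n)" for n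
    unfolding T_def by (intro integrable_mult_right ray_rGamma(1) y \<theta>)
  have Teq: "T n v = (- (of_real (x * v powr \<rho>) * cis (\<rho> * \<theta>))) ^ n / fact n * (exp (of_real v * cis \<theta>) * cis \<theta>)" if "v > 0" for n v
  proof -
    have "(of_real (v powr \<rho>)) ^ n = (of_real (v powr (\<rho> * real n)) :: complex)"
      using that by (simp add: powr_power mult_ac flip: of_real_power)
    moreover have "cis (\<rho> * \<theta>) ^ n = cis (\<rho> * real n * \<theta>)"
      unfolding Complex.DeMoivre by (simp add: mult_ac)
    moreover have "(- (of_real (x * v powr \<rho>) * cis (\<rho> * \<theta>))) ^ n = of_real ((- x) ^ n) * of_real (v powr \<rho>) ^ n * cis (\<rho> * \<theta>) ^ n"
      by (simp add: mult.assoc flip: power_mult_distrib)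
    ultimately show ?thesis
      by (simp add: T_def mult_ac)
  qed
  have sumT: "(\<lambda>n. T n v) sums (exp (of_real v * cis \<theta> - of_real (x * v powr \<rho>) * cis (\<rho> * \<theta>)) * cis \<theta>)"
    and sn: "summable (\<lambda>n. norm (T n v))" if v: "v > 0" for v
  proof -
    define u where "u = - (of_real (x * v powr \<rho>) * cis (\<rho> * \<theta>))"
    have "(\<lambda>n. u ^ n / fact n) sums exp u"
      using exp_converges[of u] by (simp add: scaleR_conv_of_real divide_inverse mult_ac)
    from sums_mult2[OF this, of "exp (of_real v * cis \<theta>) * cis \<theta>"]
    have "(\<lambda>n. T n v) sums (exp u * (exp (of_real v * cis \<theta>) * cis \<theta>))"
      unfolding Teq[OF v] u_def .
    then show "(\<lambda>n. T n v) sums (exp (of_real v * cis \<theta> - of_real (x * v powr \<rho>) * cis (\<rho> * \<theta>)) * cis \<theta>)"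
      by (simp add: u_def exp_diff exp_minus divide_inverse mult_ac)
    have "summable (\<lambda>n. cmod u ^ n / fact n * cmod (exp (of_real v * cis \<theta>) * cis \<theta>))"
      by (intro summable_mult2 summable_exp_of_real)
    then show "summable (\<lambda>n. norm (T n v))"
      unfolding Teq[OF v] u_def[symmetric] by (simp add: norm_mult norm_divide norm_power)
  qed
  have vn: "(\<integral>v. norm (T n v) \<partial>pos_lborel) = x ^ n / fact n * (Gamma (1 + \<rho> * real n) * (- cos \<theta>) powr (- (1 + \<rho> * real n)))" for n
  proof -
    have "norm (T n v) = x ^ n / fact n * (v powr (1 + \<rho> * real n - 1) * exp (- (- cos \<theta>) * v))" for v
      using x by (simp add: T_def norm_mult norm_divide norm_power mult_ac)
    then have "(\<integral>v. norm (T n v) \<partial>pos_lborel) = x ^ n / fact n * (\<integral>v. v powr (1 + \<rho> * real n - 1) * exp (- (- cos \<theta>) * v) \<partial>pos_lborel)"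
      by (simp only: integral_mult_right_zero)
    also have "(\<integral>v. v powr (1 + \<rho> * real n - 1) * exp (- (- cos \<theta>) * v) \<partial>pos_lborel) = Gamma (1 + \<rho> * real n) * (- cos \<theta>) powr (- (1 + \<rho> * real n))"
      using y[of n] c by (intro gamma_integral_pos) auto
    finally show ?thesis .
  qed
  have sni: "summable (\<lambda>n. \<integral>v. norm (T n v) \<partial>pos_lborel)"
    unfolding vn using x \<rho> c by (intro summable_Gamma_over_fact) auto
  have "(\<lambda>n. integral\<^sup>L pos_lborel (T n)) sums (\<integral>v. (\<Sum>n. T n v) \<partial>pos_lborel)"
    using sn by (intro sums_integral int sni) (auto intro!: AE_I2)
  also have "(\<integral>v. (\<Sum>n. T n v) \<partial>pos_lborel) =
     (\<integral>v. exp (of_real v * cis \<theta> - of_real (x * v powr \<rho>) * cis (\<rho> * \<theta>)) * cis \<theta> \<partial>pos_lborel)"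
    using sumT by (intro Bochner_Integration.integral_cong) (auto simp: sums_iff)
  finally have "(\<lambda>n. Im (integral\<^sup>L pos_lborel (T n)) / pi) sums (Im \<dots> / pi)"
    by (intro sums_divide sums_Im)
  moreover have "Im (integral\<^sup>L pos_lborel (T n)) / pi = (- x) ^ n / fact n * rGamma (- \<rho> * real n)" for n
  proof -
    have "Im (integral\<^sup>L pos_lborel (T n)) = (- x) ^ n / fact n * (pi * rGamma (- (\<rho> * real n)))"
      unfolding T_def integral_mult_right_zero ray_rGamma(2)[OF y \<theta>, symmetric]
      by (simp only: Im_complex_of_real Re_complex_of_real times_complex.simps mult_zero_left add_0_right)
    then show ?thesis by simp
  qed
  \<comment> \<open>The term n = 0 of the exponential series contributes \<open>rGamma 0\<close>,
    which is 0, so the sum may start at 1.\<close>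
  ultimately have "(\<lambda>n. (- x) ^ Suc n / fact (Suc n) * rGamma (- \<rho> * real (Suc n))) sums
    (Im (\<integral>v. exp (of_real v * cis \<theta> - of_real (x * v powr \<rho>) * cis (\<rho> * \<theta>)) * cis \<theta> \<partial>pos_lborel) / pi)"
    by (subst sums_Suc_iff) simp
  then show ?thesis by (simp add: reduced_wright_def sums_iff)
qed

text \<open>The bound |\<phi>(1, 0; -s)| \<le> s makes the double integral absolutely convergent,
  with inner norm integrals at most c^(-2) exp (- x c v^\<rho>). The Laplace transform then
  integrates out s, and its factor v^2 cancels the 1/v^2 of the substitution.\<close>

lemma reduced_wright_convolution_one:
  fixes \<rho> x :: real
  assumes \<rho>: "0 < \<rho>" "\<rho> < 1" and x: "x > 0"
  shows "integrable pos_lborel (\<lambda>s. reduced_wright 1 (- s) * reduced_wright \<rho> (- (x * s powr \<rho>)) / s)"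
    and "reduced_wright (- \<rho>) (- x) =
      (\<integral>s. reduced_wright 1 (- s) * reduced_wright \<rho> (- (x * s powr \<rho>)) / s \<partial>pos_lborel)"
proof -
  define \<theta> where "\<theta> = pi / (1 + \<rho>)"
  note th = ray_angle[OF \<rho>, folded \<theta>_def]
  define c where "c = - cos \<theta>"
  have c: "c > 0" "cos \<theta> = - c" using th(5) by (auto simp: c_def)
  define f where "f s = reduced_wright 1 (- s)" for s
  have [measurable]: "f \<in> borel_measurable borel"
    unfolding f_def reduced_wright_def by measurable
  have fle: "\<bar>f s\<bar> \<le> s" if "s > 0" for s
    unfolding f_def using that by (intro abs_reduced_wright_one_le) simp
  define E where "E v s = exp (of_real (s / v) * cis \<theta> - of_real (x * v powr \<rho>) * cis (- (\<rho> * \<theta>))) * cis \<theta>" for v s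
  \<comment> \<open>The factor f s / v^2 combines f s / s from the convolution integrand with the
    Jacobian s / v^2 of r = s/v.\<close>
  define k where "k v s = of_real (f s / v\<^sup>2) * E v s" for v s
  have [measurable]: "case_prod k \<in> borel_measurable (pos_lborel \<Otimes>\<^sub>M pos_lborel)"
    unfolding k_def E_def by measurable
  have kk: "k v s = (of_real (1 / v\<^sup>2) * exp (- (of_real (x * v powr \<rho>) * cis (- (\<rho> * \<theta>)))) * cis \<theta>) * (of_real (f s) * exp (- (- (cis \<theta> / of_real v)) * of_real s))" for v s
    by (simp add: k_def E_def exp_diff exp_minus divide_inverse mult_ac)
  have inner: "integrable pos_lborel (k v)"
    "integral\<^sup>L pos_lborel (k v) = - cnj (exp (of_real v * cis \<theta> - of_real (x * v powr \<rho>) * cis (\<rho> * \<theta>)) * cis \<theta>)"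
    "norm (\<integral>s. norm (k v s) \<partial>pos_lborel) \<le> norm (1 / c\<^sup>2 * exp (- (x * c * v powr \<rho>)))"
    if v: "v > 0" for v
  proof -
    \<comment> \<open>As a function of s the kernel is a constant times f s exp (- p s) with this p,
      whose real part is c / v.\<close>
    define p where "p = - (cis \<theta> / of_real v)"
    have p: "Re p > 0" using v c by (simp add: p_def Re_divide_of_real)
    note g = reduced_wright_one_laplace[OF p, folded f_def, unfolded p_def]
    show ik: "integrable pos_lborel (k v)"
      unfolding kk using g(1) by (rule integrable_mult_right)
    have ip: "inverse p = - (of_real v * cis (- \<theta>))"
      by (simp add: p_def cis_inverse[symmetric] field_simps del: cis_inverse)
    have "1 / p\<^sup>2 = (of_real v)\<^sup>2 * (cis (- \<theta>))\<^sup>2"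
      using ip by (metis inverse_eq_divide power2_minus power_inverse power_mult_distrib)
    then have "- exp (- inverse p) / p\<^sup>2 = - (exp (of_real v * cis (- \<theta>)) * ((of_real v)\<^sup>2 * (cis (- \<theta>))\<^sup>2))"
      unfolding ip by (simp add: divide_inverse)
    then have "integral\<^sup>L pos_lborel (k v) = (of_real (1 / v\<^sup>2) * exp (- (of_real (x * v powr \<rho>) * cis (- (\<rho> * \<theta>)))) * cis \<theta>) *
        - (exp (of_real v * cis (- \<theta>)) * ((of_real v)\<^sup>2 * (cis (- \<theta>))\<^sup>2))"
      unfolding kk integral_mult_right_zero g(2) p_def by simp
    also have "\<dots> = - (exp (of_real v * cis (- \<theta>)) * exp (- (of_real (x * v powr \<rho>) * cis (- (\<rho> * \<theta>)))) * cis (- \<theta>)) * (cis \<theta> * cis (- \<theta>))"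
      using v by (simp add: power2_eq_square field_simps)
    also have "\<dots> = - cnj (exp (of_real v * cis \<theta> - of_real (x * v powr \<rho>) * cis (\<rho> * \<theta>)) * cis \<theta>)"
      by (simp add: cis_mult exp_cnj cis_cnj exp_diff exp_minus divide_inverse)
    finally show "integral\<^sup>L pos_lborel (k v) = - cnj (exp (of_real v * cis \<theta> - of_real (x * v powr \<rho>) * cis (\<rho> * \<theta>)) * cis \<theta>)" .
    have cv: "c / v > 0" using c v by simp
    note gg = gamma_integral_pos[of 2 "c / v", OF _ cv, simplified]
    have nk: "norm (k v s) \<le> (1 / v\<^sup>2 * exp (- (x * c * v powr \<rho>))) * (s powr (2 - 1) * exp (- (c / v) * s))" if "s > 0" for s
    proof -
      have "norm (k v s) = \<bar>f s\<bar> * (1 / v\<^sup>2 * exp (- (x * c * v powr \<rho>)) * exp (- (c / v) * s))"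
      proof -
        have "norm (k v s) = \<bar>f s\<bar> / v\<^sup>2 * exp (s / v * cos \<theta> - x * v powr \<rho> * cos (\<rho> * \<theta>))"
          unfolding k_def E_def norm_mult norm_of_real by simp
        also have "s / v * cos \<theta> - x * v powr \<rho> * cos (\<rho> * \<theta>) = - (x * c * v powr \<rho>) + - (c / v) * s"
          using th(4) c by (simp add: mult_ac)
        finally show ?thesis unfolding exp_add by simp
      qed
      also have "\<dots> \<le> s * (1 / v\<^sup>2 * exp (- (x * c * v powr \<rho>)) * exp (- (c / v) * s))"
        by (intro mult_right_mono fle that) auto
      finally show ?thesis using that by (simp add: mult_ac)
    qed
    have "(\<integral>s. norm (k v s) \<partial>pos_lborel) \<le> (\<integral>s. (1 / v\<^sup>2 * exp (- (x * c * v powr \<rho>))) * (s powr (2 - 1) * exp (- (c / v) * s)) \<partial>pos_lborel)"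
      using ik nk cv by (intro integral_mono integrable_norm integrable_mult_right gamma_integral_pos) auto
    also have "\<dots> = (1 / v\<^sup>2 * exp (- (x * c * v powr \<rho>))) * (Gamma 2 * (c / v) powr (- 2))"
      unfolding integral_mult_right_zero using cv by (subst gamma_integral_pos(2)) auto
    also have "Gamma (2 :: real) = 1" using Gamma_fact[of 1, where 'a = real] by simp
    also have "(c / v) powr (- 2) = v\<^sup>2 / c\<^sup>2"
      using cv powr_realpow[of "c / v" 2] by (simp add: powr_minus power_divide)
    finally have "(\<integral>s. norm (k v s) \<partial>pos_lborel) \<le> 1 / c\<^sup>2 * exp (- (x * c * v powr \<rho>))"
      using v by simp
    then show "norm (\<integral>s. norm (k v s) \<partial>pos_lborel) \<le> norm (1 / c\<^sup>2 * exp (- (x * c * v powr \<rho>)))"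
      by simp
  qed
  have ik: "integrable (pos_lborel \<Otimes>\<^sub>M pos_lborel) (case_prod k)"
  proof (rule pos_lborel.Fubini_integrable)
    show "integrable pos_lborel (\<lambda>v. \<integral>s. norm (case_prod k (v, s)) \<partial>pos_lborel)"
    proof (rule Bochner_Integration.integrable_bound)
      show "integrable pos_lborel (\<lambda>v. 1 / c\<^sup>2 * exp (- (x * c * v powr \<rho>)))"
        using \<rho> x c by (intro integrable_mult_right integrable_exp_neg_powr) auto
      show "AE v in pos_lborel. norm (\<integral>s. norm (case_prod k (v, s)) \<partial>pos_lborel) \<le> norm (1 / c\<^sup>2 * exp (- (x * c * v powr \<rho>)))"
        using inner(3) by (intro AE_I2) simp
    qed measurable
    show "AE v in pos_lborel. integrable pos_lborel (\<lambda>s. case_prod k (v, s))"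
      using inner(1) by (intro AE_I2) auto
  qed simp
  \<comment> \<open>Integrability in v is required of the given s, because Fubini provides it for
    almost every s.\<close>
  have snd: "Im (\<integral>v. k v s \<partial>pos_lborel) / pi = reduced_wright 1 (- s) * reduced_wright \<rho> (- (x * s powr \<rho>)) / s" if s: "s > 0" "integrable pos_lborel (\<lambda>v. k v s)" for s
  proof -
    define g where "g r = exp (of_real r * cis \<theta> - of_real (x * s powr \<rho> * r powr (- \<rho>)) * cis (- (\<rho> * \<theta>))) * cis \<theta>" for r
    have gm: "g \<in> borel_measurable pos_lborel" unfolding g_def by measurable
    have ig: "integrable pos_lborel g"
    proof (rule integrable_pos_lborel_bound[OF gm, of 1 c 1])
      show "norm (g r) \<le> 1 * (r powr (1 - 1) * exp (- c * r))" if "r > 0" for r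
        using that x s(1) c th(4) by (simp add: g_def norm_mult mult_ac)
    qed (use c in auto)
    \<comment> \<open>This identity is what removes s from the power term of the exponent.\<close>
    have sv: "s powr \<rho> * (s / v) powr (- \<rho>) = v powr \<rho>" if "v > 0" for v
      using that s by (simp add: powr_divide powr_minus field_simps)
    have "pi * reduced_wright \<rho> (- (x * s powr \<rho>)) = Im (integral\<^sup>L pos_lborel g)"
      using reduced_wright_ray[OF \<rho>(1) th(1-3), of "x * s powr \<rho>"] x s by (simp add: g_def[abs_def])
    also have "\<dots> = (\<integral>r. Im (g r) \<partial>pos_lborel)"
      using ig by simp
    also have "\<dots> = (\<integral>v. s / v\<^sup>2 * Im (g (s / v)) \<partial>pos_lborel)"
      using ig s by (intro pos_lborel_reciprocal_substitution integrable_Im)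
    finally have 1: "pi * reduced_wright \<rho> (- (x * s powr \<rho>)) = (\<integral>v. s / v\<^sup>2 * Im (g (s / v)) \<partial>pos_lborel)" .
    have "Im (\<integral>v. k v s \<partial>pos_lborel) = (\<integral>v. Im (k v s) \<partial>pos_lborel)"
      using s(2) by simp
    also have "\<dots> = (\<integral>v. f s / s * (s / v\<^sup>2 * Im (g (s / v))) \<partial>pos_lborel)"
    proof (intro Bochner_Integration.integral_cong refl)
      fix v assume "v \<in> space pos_lborel"
      then have v: "v > 0" by simp
      have "g (s / v) = E v s"
        using sv[OF v] by (simp add: g_def E_def mult.assoc del: of_real_mult)
      moreover have "Im (k v s) = f s / v\<^sup>2 * Im (E v s)"
        unfolding k_def by (simp only: Im_complex_of_real Re_complex_of_real times_complex.simps mult_zero_left add_0_right)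
      ultimately show "Im (k v s) = f s / s * (s / v\<^sup>2 * Im (g (s / v)))"
        using s by simp
    qed
    also have "\<dots> = f s / s * (pi * reduced_wright \<rho> (- (x * s powr \<rho>)))"
      unfolding 1 integral_mult_right_zero ..
    finally show ?thesis by (simp add: f_def)
  qed
  have isnd: "integrable pos_lborel (\<lambda>s. Im (\<integral>v. k v s \<partial>pos_lborel) / pi)"
    by (intro integrable_divide integrable_Im pos_lborel.integrable_snd ik)
  have ae: "AE s in pos_lborel. Im (\<integral>v. k v s \<partial>pos_lborel) / pi = reduced_wright 1 (- s) * reduced_wright \<rho> (- (x * s powr \<rho>)) / s"
    using pos_lborel.AE_integrable_snd[OF ik] AE_space by eventually_elim (simp add: snd)
  have m: "(\<lambda>s. reduced_wright 1 (- s) * reduced_wright \<rho> (- (x * s powr \<rho>)) / s) \<in> borel_measurable pos_lborel"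
    unfolding reduced_wright_def by measurable
  show "integrable pos_lborel (\<lambda>s. reduced_wright 1 (- s) * reduced_wright \<rho> (- (x * s powr \<rho>)) / s)"
    using isnd by (rule integrable_cong_AE_imp[OF _ m]) (use ae in \<open>auto elim: eventually_mono\<close>)
  have "(\<integral>s. reduced_wright 1 (- s) * reduced_wright \<rho> (- (x * s powr \<rho>)) / s \<partial>pos_lborel) = (\<integral>s. Im (\<integral>v. k v s \<partial>pos_lborel) / pi \<partial>pos_lborel)"
    using ae isnd m by (intro integral_cong_AE) (auto elim: eventually_mono intro: borel_measurable_integrable)
  also have "\<dots> = Im (\<integral>s. (\<integral>v. k v s \<partial>pos_lborel) \<partial>pos_lborel) / pi"
    using integral_Im[OF pos_lborel.integrable_snd[OF ik]] by simp
  also have "(\<integral>s. (\<integral>v. k v s \<partial>pos_lborel) \<partial>pos_lborel) = (\<integral>v. (\<integral>s. k v s \<partial>pos_lborel) \<partial>pos_lborel)"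
    by (rule pos_lborel.Fubini_integral[OF ik])
  also have "\<dots> = (\<integral>v. - cnj (exp (of_real v * cis \<theta> - of_real (x * v powr \<rho>) * cis (\<rho> * \<theta>)) * cis \<theta>) \<partial>pos_lborel)"
    using inner(2) by (intro Bochner_Integration.integral_cong) auto
  also have "\<dots> = - cnj (\<integral>v. exp (of_real v * cis \<theta> - of_real (x * v powr \<rho>) * cis (\<rho> * \<theta>)) * cis \<theta> \<partial>pos_lborel)"
    unfolding Bochner_Integration.integral_minus Bochner_Integration.integral_cnj ..
  \<comment> \<open>Negation and conjugation cancel each other in the imaginary part.\<close>
  also have "Im \<dots> / pi = reduced_wright (- \<rho>) (- x)"
    using reduced_wright_negative_ray[OF \<rho> th(1,2) x] by (simp del: Bochner_Integration.integral_cnj)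
  finally show "reduced_wright (- \<rho>) (- x) =
      (\<integral>s. reduced_wright 1 (- s) * reduced_wright \<rho> (- (x * s powr \<rho>)) / s \<partial>pos_lborel)" by simp
qed

section \<open>The two ranges of the first parameter\<close>

theorem theorem4:
  fixes \<rho>1 \<rho>2 x :: real
  assumes "\<rho>1 > 0" and "\<rho>2 > 0"
    and "(\<rho>1 \<le> 1 \<and> \<rho>2 < 1) \<or> (\<rho>1 < 1 \<and> \<rho>2 \<ge> 1 \<and> \<rho>1 * \<rho>2 < 1)"
    and "x > 0"
  shows "set_integrable lborel {0<..}
           (\<lambda>s. reduced_wright \<rho>1 (- s) * reduced_wright \<rho>2 (- (x * s powr \<rho>2)) / s)
       \<and> reduced_wright (- (\<rho>1 * \<rho>2)) (- x) =
           (LBINT s:{0<..}. reduced_wright \<rho>1 (- s) * reduced_wright \<rho>2 (- (x * s powr \<rho>2)) / s)"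
proof (cases "\<rho>1 = 1")
  case True
  then have "\<rho>2 < 1" using assms by auto
  from reduced_wright_convolution_one[OF assms(2) this assms(4)] show ?thesis
    unfolding integrable_pos_lborel_iff integral_pos_lborel by (simp add: True)
next
  case False
  then have 1: "\<rho>1 < 1" using assms by auto
  \<comment> \<open>With \<rho>1 < 1, both factors are below 1 in the first alternative; the second
    alternative contains the inequality.\<close>
  have "\<rho>1 * \<rho>2 < 1"
    using assms 1 by (metis less_eq_real_def mult_less_cancel_left2 mult.commute order_less_trans mult_less_cancel_right1 not_less)
  from reduced_wright_convolution_less_one[OF assms(1) 1 assms(2) this assms(4)] show ?thesis
    unfolding integrable_pos_lborel_iff integral_pos_lborel by simp
qed

end
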